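(* Let $H$ be a contextuality scenario. For $p\in\mathcal{G}(H)$, the following are equivalent: (a) $p\in\mathcal{Q}_1(H)$; (b) there exist a Hilbert space $\mathcal{H}$, a unit vector $|\Psi\rangle\in\mathcal{H}$ and a vector $|\phi_v\rangle\in\mathcal{H}$ for every $v\in V(H)$ such that $u\perp v$ implies $\langle\phi_u|\phi_v\rangle=0$; $\sum_{v\in e}|\phi_v\rangle=|\Psi\rangle$ for all $e\in E(H)$; and $p(v)=\langle\phi_v|\phi_v\rangle$ for all $v\in V(H)$; (c) there exist a Hilbert space $\mathcal{H}$, a unit vector $|\Psi\rangle\in\mathcal{H}$ and a unit vector $|\psi_v\rangle\in\mathcal{H}$ for every $v\in V(H)$ such that $u\perp v$ implies $\langle\psi_u|\psi_v\rangle=0$, and $p(v)=|\langle\psi_v|\Psi\rangle|^2$ for all $v\in V(H)$; (d) there exist a Hilbert space $\mathcal{H}$, a unit vector $|\Psi\rangle\in\mathcal{H}$ and a projection $P_v$ on $\mathcal{H}$ for every $v\in V(H)$ such that $u\perp v$ implies $P_u\perp P_v$ (i.e. $P_uP_v=0$), and $p(v)=\langle\Psi|P_v|\Psi\rangle$ for all $v\in V(H)$; (e) there exist a Hilbert space $\mathcal{H}$, a unit vector $|\Psi\rangle\in\mathcal{H}$ and a projection $P_v$ on $\mathcal{H}$ for every $v\in V(H)$ such that $\sum_{v\in e}P_v\leq\mathbbm{1}_{\mathcal{H}}$ for all $e\in E(H)$, and $p(v)=\langle\Psi|P_v|\Psi\rangle$ for all $v\in V(H)$. In all cases (b)–(e),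 $\mathcal{H}$ can also be taken to be the real Hilbert space $\mathbb{R}^{|V(H)|}$.
   Context: A contextuality scenario is a hypergraph $H$ with finite nonempty vertex set $V(H)$ and edge set $E(H)\subseteq 2^{V(H)}$ such that $\bigcup_{e\in E(H)}e=V(H)$. A probabilistic model on $H$ is a map $p:V(H)\to[0,1]$ with $\sum_{v\in e}p(v)=1$ for all $e\in E(H)$; $\mathcal{G}(H)$ is the set of these. For $u,v\in V(H)$ write $u\perp v$ if $u\neq v$ and some edge contains both. Hilbert spaces are complex and possibly infinite-dimensional unless stated otherwise; projections are orthogonal projections. $\mathcal{Q}_1(H)$ is the set of $p:V(H)\to[0,1]$ for which there is a positive semidefinite complex matrix $M$ with rows and columns indexed by $V(H)\cup\{\emptyset\}$ ($\emptyset$ being an extra index symbol) such that $M_{\emptyset,\emptyset}=1$; $\sum_{x\in e}M_{x,w}=M_{\emptyset,w}$ for all $e\in E(H)$ and all $w\in V(H)\cup\{\emptyset\}$; $M_{u,v}=0$ whenever $u\perp v$; and $p(v)=M_{v,\emptyset}$ for all $v\in V(H)$. *)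

theory Defs
  imports "HOL-Analysis.Analysis" "HOL-Algebra.Algebraic_Closure_Type"
begin

section \<open>Contextuality scenarios\<close>

definition contextuality_scenario :: "'v set \<Rightarrow> 'v set set \<Rightarrow> bool" where
  "contextuality_scenario V E \<longleftrightarrow> finite V \<and> V \<noteq> {} \<and> E \<subseteq> Pow V \<and> \<Union>E = V"

definition orthogonal_vertices :: "'v set set \<Rightarrow> 'v \<Rightarrow> 'v \<Rightarrow> bool" where
  "orthogonal_vertices E u v \<longleftrightarrow> u \<noteq> v \<and> (\<exists>e\<in>E. u \<in> e \<and> v \<in> e)"

(* Models are total functions on the vertex type; only their values on V matter. *)
definition probabilistic_models :: "'v set \<Rightarrow> 'v set set \<Rightarrow> ('v \<Rightarrow> real) set" where
  "probabilistic_models V E = {p. p \<in> V \<rightarrow> {0..1} \<and> (\<forall>e\<in>E. (\<Sum>v\<in>e. p v) = 1)}"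

definition positive_semidefinite_on :: "'i set \<Rightarrow> ('i \<Rightarrow> 'i \<Rightarrow> complex) \<Rightarrow> bool" where
  "positive_semidefinite_on I M \<longleftrightarrow>
     (\<forall>i\<in>I. \<forall>j\<in>I. M j i = cnj (M i j)) \<and>
     (\<forall>x. 0 \<le> Re (\<Sum>i\<in>I. \<Sum>j\<in>I. cnj (x i) * M i j * x j))"

(* The extra index is None; a vertex v is the index Some v. *)
definition Q1_models :: "'v set \<Rightarrow> 'v set set \<Rightarrow> ('v \<Rightarrow> real) set" where
  "Q1_models V E = {p. p \<in> V \<rightarrow> {0..1} \<and>
     (\<exists>M. positive_semidefinite_on (insert None (Some ` V)) M \<and>
        M None None = 1 \<and>
        (\<forall>e\<in>E. \<forall>w\<in>insert None (Some ` V). (\<Sum>x\<in>e. M (Some x) w) = M None w) \<and>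
        (\<forall>u\<in>V. \<forall>v\<in>V. orthogonal_vertices E u v \<longrightarrow> M (Some u) (Some v) = 0) \<and>
        (\<forall>v\<in>V. complex_of_real (p v) = M (Some v) None))}"


section \<open>Hilbert spaces\<close>

(* A space is given by an explicit carrier, so that one can quantify over Hilbert spaces within
   a formula.  The fields mult and one inherited from the ring record play no role. *)
record ('k, 'h) hspace = "('k, 'h) module" +
  hinner :: "'h \<Rightarrow> 'h \<Rightarrow> 'k"

(* The inner product is linear in the second argument, as in bra-ket notation. *)
locale complex_hilbert_space =
  module "ring_of_type_algebra :: complex ring" H
  for H :: "(complex, 'h) hspace" (structure) +
  assumes hinner_add_right:
      "\<lbrakk>x \<in> carrier H; y \<in> carrier H; z \<in> carrier H\<rbrakk> \<Longrightarrow>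
       hinner H x (y \<oplus> z) = hinner H x y + hinner H x z"
    and hinner_smult_right:
      "\<lbrakk>x \<in> carrier H; y \<in> carrier H\<rbrakk> \<Longrightarrow> hinner H x (a \<odot> y) = a * hinner H x y"
    and hinner_commute:
      "\<lbrakk>x \<in> carrier H; y \<in> carrier H\<rbrakk> \<Longrightarrow> hinner H y x = cnj (hinner H x y)"
    and hinner_nonneg: "x \<in> carrier H \<Longrightarrow> 0 \<le> Re (hinner H x x)"
    and hinner_eq_zero: "\<lbrakk>x \<in> carrier H; hinner H x x = 0\<rbrakk> \<Longrightarrow> x = \<zero>"
    and hcomplete:
      "Metric_space.mcomplete (carrier H) (\<lambda>x y. sqrt (Re (hinner H (x \<ominus> y) (x \<ominus> y))))"

definition euclidean_hspace :: "(real, real ^ 'n) hspace" where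
  "euclidean_hspace =
     \<lparr>carrier = UNIV, monoid.mult = undefined, one = undefined, ring.zero = 0, add = (+),
      module.smult = (*\<^sub>R), hinner = (\<bullet>)\<rparr>"

definition unit_vector :: "('k::real_normed_field, 'h) hspace \<Rightarrow> 'h \<Rightarrow> bool" where
  "unit_vector H x \<longleftrightarrow> x \<in> carrier H \<and> hinner H x x = 1"

(* Boundedness is automatic: |P x|^2 = <x|P x> implies |P x| <= |x|. *)
definition projection_on :: "('k::real_normed_field, 'h) hspace \<Rightarrow> ('h \<Rightarrow> 'h) \<Rightarrow> bool" where
  "projection_on H P \<longleftrightarrow>
     P \<in> carrier H \<rightarrow> carrier H \<and>
     (\<forall>x\<in>carrier H. \<forall>y\<in>carrier H. P (x \<oplus>\<^bsub>H\<^esub> y) = P x \<oplus>\<^bsub>H\<^esub> P y) \<and>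
     (\<forall>a. \<forall>x\<in>carrier H. P (a \<odot>\<^bsub>H\<^esub> x) = a \<odot>\<^bsub>H\<^esub> P x) \<and>
     (\<forall>x\<in>carrier H. P (P x) = P x) \<and>
     (\<forall>x\<in>carrier H. \<forall>y\<in>carrier H. hinner H (P x) y = hinner H x (P y))"

(* T \<le> 1 in the operator order: <x|(1 - T) x> is real and nonnegative for all x. *)
definition below_identity :: "('k::real_normed_field, 'h) hspace \<Rightarrow> ('h \<Rightarrow> 'h) \<Rightarrow> bool" where
  "below_identity H T \<longleftrightarrow>
     (\<forall>x\<in>carrier H. \<exists>r::real. 0 \<le> r \<and> hinner H x (x \<ominus>\<^bsub>H\<^esub> T x) = of_real r)"


section \<open>Realizations of a model in a given Hilbert space\<close>

definition vector_decomposition ::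
  "('k::real_normed_field, 'h) hspace \<Rightarrow> 'v set \<Rightarrow> 'v set set \<Rightarrow> ('v \<Rightarrow> real) \<Rightarrow> bool" where
  "vector_decomposition H V E p \<longleftrightarrow>
     (\<exists>\<Psi> \<phi>. unit_vector H \<Psi> \<and> \<phi> \<in> V \<rightarrow> carrier H \<and>
        (\<forall>u\<in>V. \<forall>v\<in>V. orthogonal_vertices E u v \<longrightarrow> hinner H (\<phi> u) (\<phi> v) = 0) \<and>
        (\<forall>e\<in>E. finsum H \<phi> e = \<Psi>) \<and>
        (\<forall>v\<in>V. of_real (p v) = hinner H (\<phi> v) (\<phi> v)))"

definition unit_vector_representation ::
  "('k::real_normed_field, 'h) hspace \<Rightarrow> 'v set \<Rightarrow> 'v set set \<Rightarrow> ('v \<Rightarrow> real) \<Rightarrow> bool" where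
  "unit_vector_representation H V E p \<longleftrightarrow>
     (\<exists>\<Psi> \<psi>. unit_vector H \<Psi> \<and> (\<forall>v\<in>V. unit_vector H (\<psi> v)) \<and>
        (\<forall>u\<in>V. \<forall>v\<in>V. orthogonal_vertices E u v \<longrightarrow> hinner H (\<psi> u) (\<psi> v) = 0) \<and>
        (\<forall>v\<in>V. p v = (norm (hinner H (\<psi> v) \<Psi>))\<^sup>2))"

definition orthogonal_projection_representation ::
  "('k::real_normed_field, 'h) hspace \<Rightarrow> 'v set \<Rightarrow> 'v set set \<Rightarrow> ('v \<Rightarrow> real) \<Rightarrow> bool" where
  "orthogonal_projection_representation H V E p \<longleftrightarrow>
     (\<exists>\<Psi> P. unit_vector H \<Psi> \<and> (\<forall>v\<in>V. projection_on H (P v)) \<and>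
        (\<forall>u\<in>V. \<forall>v\<in>V. orthogonal_vertices E u v \<longrightarrow>
           (\<forall>x\<in>carrier H. P u (P v x) = \<zero>\<^bsub>H\<^esub>)) \<and>
        (\<forall>v\<in>V. of_real (p v) = hinner H \<Psi> (P v \<Psi>)))"

definition subnormalized_projection_representation ::
  "('k::real_normed_field, 'h) hspace \<Rightarrow> 'v set \<Rightarrow> 'v set set \<Rightarrow> ('v \<Rightarrow> real) \<Rightarrow> bool" where
  "subnormalized_projection_representation H V E p \<longleftrightarrow>
     (\<exists>\<Psi> P. unit_vector H \<Psi> \<and> (\<forall>v\<in>V. projection_on H (P v)) \<and>
        (\<forall>e\<in>E. below_identity H (\<lambda>x. finsum H (\<lambda>v. P v x) e)) \<and>
        (\<forall>v\<in>V. of_real (p v) = hinner H \<Psi> (P v \<Psi>)))"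

end

theory Submission
  imports Defs
begin

text \<open>
  The real part of a \<open>Q1\<close> matrix, restricted to the vertices, is positive semidefinite, so it is the
  Gram matrix of vectors \<open>f v\<close> in a real space of dimension \<open>|V|\<close>.  The summation conditions say that
  \<open>\<Sum>v\<in>e. f v\<close> has the same inner products for all edges, hence is a single unit vector \<open>\<Psi>\<close>.
  Normalizing the nonzero \<open>f v\<close> gives unit vectors; there is room in dimension \<open>|V|\<close> for those with
  \<open>p v = 0\<close> as the Cholesky factorization leaves the coordinates of these vertices unused.  Unit
  vectors yield rank one projections.  Conversely, projections give the vectors \<open>P v \<Psi>\<close>, whose sum
  over an edge is a projection of \<open>\<Psi>\<close> with the same length as \<open>\<Psi>\<close>, hence \<open>\<Psi>\<close> itself; and the real
  part of the Gram matrix of \<open>\<Psi>\<close> and these vectors is a \<open>Q1\<close> matrix.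
\<close>

section \<open>Gram vectors of real positive semidefinite matrices\<close>

text \<open>Splitting off the variable \<open>x a\<close> displays the form as a quadratic
  polynomial in it. Both the argument for zero diagonal entries and the completion of the square
  below start from this shape.\<close>

lemma quadratic_form_insert:
  fixes A :: "'v \<Rightarrow> 'v \<Rightarrow> real"
  assumes "finite F" "a \<notin> F" and sym: "\<And>v. v \<in> F \<Longrightarrow> A v a = A a v"
  shows "(\<Sum>i\<in>insert a F. \<Sum>j\<in>insert a F. x i * A i j * x j) =
    (x a)\<^sup>2 * A a a + 2 * x a * (\<Sum>v\<in>F. A a v * x v) + (\<Sum>i\<in>F. \<Sum>j\<in>F. x i * A i j * x j)"
  using assms(1,2)
  by (simp add: sum.distrib sum_distrib_left sum_distrib_right sym power2_eq_square algebra_simps)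

lemma linear_nonneg_imp_zero:
  fixes b c :: real
  assumes "\<And>t. 0 \<le> t * b + c"
  shows "b = 0"
proof (rule ccontr)
  assume "b \<noteq> 0"
  then show False using assms[of "(- c - 1) / b"] by simp
qed

text \<open>At the vector with entry \<open>t\<close> at \<open>a\<close> and entry 1 at
  \<open>v\<close>, the zero diagonal entry removes the term in \<open>t\<close> squared. The form
  is then affine in \<open>t\<close> with slope \<open>2 * A a v\<close>, and staying nonnegative
  for all \<open>t\<close> forces the slope to be 0.\<close>

lemma psd_zero_diagonal:
  fixes A :: "'v \<Rightarrow> 'v \<Rightarrow> real"
  assumes "finite V" and sym: "\<And>u v. \<lbrakk>u \<in> V; v \<in> V\<rbrakk> \<Longrightarrow> A u v = A v u"
    and psd: "\<And>x. 0 \<le> (\<Sum>i\<in>V. \<Sum>j\<in>V. x i * A i j * x j)"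
    and a: "a \<in> V" "A a a = 0" and v: "v \<in> V"
  shows "A a v = 0"
proof (cases "v = a")
  case False
  define F where "F = V - {a}"
  have V: "V = insert a F" and F: "finite F" "a \<notin> F" "v \<in> F"
    using assms False by (auto simp: F_def)
  have "0 \<le> t * (2 * A a v) + A v v" for t
  proof -
    define x where "x = (\<lambda>k. if k = a then t else if k = v then 1 else (0::real))"
    have x: "x k = (if k = v then 1 else 0)" if "k \<in> F" for k
      using that F by (auto simp: x_def)
    have "(\<Sum>k\<in>F. A a k * x k) = (\<Sum>k\<in>F. if k = v then A a v else 0)"
      by (intro sum.cong) (auto simp: x)
    moreover have "(\<Sum>i\<in>F. \<Sum>j\<in>F. x i * A i j * x j) = (\<Sum>i\<in>F. \<Sum>j\<in>F. if j = v then if i = v then A v v else 0 else 0)"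
      by (intro sum.cong) (auto simp: x)
    moreover have "0 \<le> (x a)\<^sup>2 * A a a + 2 * x a * (\<Sum>v\<in>F. A a v * x v)
        + (\<Sum>i\<in>F. \<Sum>j\<in>F. x i * A i j * x j)"
      using psd[of x] unfolding V
      by (subst (asm) quadratic_form_insert) (use F V sym in auto)
    ultimately show ?thesis
      using F a by (simp add: x_def mult_ac)
  qed
  then show ?thesis using linear_nonneg_imp_zero by fastforce
qed (use a in simp)

text \<open>Cholesky factorization: the induction eliminates one index by passing to the Schur
  complement.  If the pivot is \<open>0\<close>, its row vanishes, and the formulas remain correct because
  \<open>x / 0 = 0\<close>.\<close>

lemma psd_gram:
  fixes A :: "'v \<Rightarrow> 'v \<Rightarrow> real"
  assumes "finite V" and "\<And>u v. \<lbrakk>u \<in> V; v \<in> V\<rbrakk> \<Longrightarrow> A u v = A v u"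
    and "\<And>x. 0 \<le> (\<Sum>i\<in>V. \<Sum>j\<in>V. x i * A i j * x j)"
  shows "\<exists>f. (\<forall>u\<in>V. \<forall>v\<in>V. A u v = (\<Sum>k\<in>V. f u k * f v k)) \<and>
     (\<forall>u\<in>V. \<forall>k\<in>V. A k k = 0 \<longrightarrow> f u k = 0)"
  using assms
proof (induction V arbitrary: A rule: finite_induct)
  case (insert a F)
  note sym = insert.prems(1) and psd = insert.prems(2)
  have zero: "A k v = 0" if "k \<in> insert a F" "A k k = 0" "v \<in> insert a F" for k v
    by (rule psd_zero_diagonal[where V = "insert a F"]) (use insert that in auto)
  have quad: "0 \<le> (x a)\<^sup>2 * A a a + 2 * x a * (\<Sum>v\<in>F. A a v * x v)
        + (\<Sum>i\<in>F. \<Sum>j\<in>F. x i * A i j * x j)" for x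
    using psd[of x] by (subst (asm) quadratic_form_insert) (use insert.hyps sym in auto)
  have Aaa: "0 \<le> A a a"
    using quad[of "\<lambda>k. if k = a then 1 else 0"] insert.hyps
    by (simp add: if_distrib[of "\<lambda>t. _ * t"] if_distrib[of "\<lambda>t. t * _"] sum.neutral cong: if_cong)
  define B where "B u v = A u v - A u a * A a v / A a a" for u v
  have "\<exists>f. (\<forall>u\<in>F. \<forall>v\<in>F. B u v = (\<Sum>k\<in>F. f u k * f v k)) \<and>
     (\<forall>u\<in>F. \<forall>k\<in>F. B k k = 0 \<longrightarrow> f u k = 0)"
  proof (rule insert.IH)
    show "B u v = B v u" if "u \<in> F" "v \<in> F" for u v
      using that by (simp add: B_def sym)
    fix x :: "'v \<Rightarrow> real"
    define s where "s = (\<Sum>v\<in>F. A a v * x v)"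
    \<comment> \<open>For a nonzero pivot this value of the coordinate \<open>a\<close> completes
      the square and minimizes the form of \<open>A\<close>, so the form of \<open>A\<close> at
      \<open>y\<close> is the form of \<open>B\<close> at \<open>x\<close>. For a zero pivot the
      entry is 0.\<close>
    define y where "y = x(a := - s / A a a)"
    have yx: "y k = x k" if "k \<in> F" for k using that insert.hyps by (auto simp: y_def)
    have "0 \<le> (y a)\<^sup>2 * A a a + 2 * y a * s + (\<Sum>i\<in>F. \<Sum>j\<in>F. x i * A i j * x j)"
      using quad[of y] by (simp add: yx s_def cong: sum.cong)
    also have "(y a)\<^sup>2 * A a a + 2 * y a * s = - s\<^sup>2 / A a a"
      by (cases "A a a = 0") (simp_all add: y_def power2_eq_square field_simps)
    also have "- s\<^sup>2 / A a a = - (\<Sum>i\<in>F. \<Sum>j\<in>F. x i * (A i a * A a j / A a a) * x j)"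
      by (simp add: s_def power2_eq_square sum_product sum_divide_distrib sym mult_ac
          flip: sum_negf)
    finally show "0 \<le> (\<Sum>i\<in>F. \<Sum>j\<in>F. x i * B i j * x j)"
      by (simp add: B_def algebra_simps sum_subtractf)
  qed
  then obtain g where g: "\<And>u v. \<lbrakk>u \<in> F; v \<in> F\<rbrakk> \<Longrightarrow> B u v = (\<Sum>k\<in>F. g u k * g v k)"
    and g0: "\<And>u k. \<lbrakk>u \<in> F; k \<in> F; B k k = 0\<rbrakk> \<Longrightarrow> g u k = 0" by blast
  \<comment> \<open>The triangular factor: column \<open>a\<close> is the pivot column scaled by the
    root of the pivot, the rest of row \<open>a\<close> is empty, and \<open>g\<close> fills the
    remaining block.\<close>
  define f where "f u k = (if k = a then A u a / sqrt (A a a) else if u = a then 0 else g u k)" for u k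
  have fk: "f u k = (if u = a then 0 else g u k)" if "k \<in> F" for u k
    using that insert.hyps by (auto simp: f_def)
  have fa: "f u a * f v a = A u a * A a v / A a a" if "v \<in> insert a F" for u v
    using Aaa that by (simp add: f_def sym)
  have "A u v = (\<Sum>k\<in>insert a F. f u k * f v k)" if "u \<in> insert a F" "v \<in> insert a F" for u v
  proof -
    have "(\<Sum>k\<in>F. f u k * f v k) = A u v - A u a * A a v / A a a"
    \<comment> \<open>The rank one part already reproduces row and column \<open>a\<close>; for a
      zero pivot these vanish altogether. Everywhere else the remainder is \<open>B\<close>, which
      \<open>g\<close> factorizes.\<close>
    proof (cases "u = a \<or> v = a")
      case True
      then have "(\<Sum>k\<in>F. f u k * f v k) = 0" by (auto simp: fk)
      moreover have "A u v = A u a * A a v / A a a"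
        using True that zero[of a] sym[of u a] by (cases "A a a = 0") auto
      ultimately show ?thesis by simp
    next
      case False
      then have "(\<Sum>k\<in>F. f u k * f v k) = B u v" using that g by (simp add: fk)
      then show ?thesis by (simp add: B_def)
    qed
    then show ?thesis using insert.hyps fa[OF that(2)] by simp
  qed
  moreover have "f u k = 0" if "u \<in> insert a F" "k \<in> insert a F" "A k k = 0" for u k
  proof (cases "k = a")
    case True then show ?thesis using that by (simp add: f_def)
  next
    case False
    then have "k \<in> F" "B k k = 0" using that zero[of k a] by (auto simp: B_def)
    then show ?thesis using that g0 by (auto simp: fk)
  qed
  ultimately show ?case by blast
qed auto

section \<open>Inner product modules\<close>

text \<open>Real and complex spaces are treated together; \<open>cj\<close> and \<open>re\<close> stand for the conjugation and the
  real part of the scalars.\<close>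

locale inner_product_module =
  module "ring_of_type_algebra :: 'k::real_normed_field ring" H
  for H :: "('k::real_normed_field, 'h) hspace" (structure)
    and cj :: "'k::real_normed_field \<Rightarrow> 'k" and re :: "'k::real_normed_field \<Rightarrow> real" +
  assumes cj_add: "cj (a + b) = cj a + cj b"
    and cj_mult: "cj (a * b) = cj a * cj b"
    and cj_of_real: "cj (of_real r) = of_real r"
    and cj_mult_self: "cj a * a = of_real ((norm a)\<^sup>2)"
    and re_add: "re (a + b) = re a + re b"
    and re_of_real_mult: "re (of_real r * a) = r * re a"
    and re_of_real: "re (of_real r) = r"
    and re_cj: "re (cj a) = re a"
    and inner_add_right: "\<lbrakk>x \<in> carrier H; y \<in> carrier H; z \<in> carrier H\<rbrakk> \<Longrightarrow>
       hinner H x (y \<oplus> z) = hinner H x y + hinner H x z"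
    and inner_smult_right:
      "\<lbrakk>x \<in> carrier H; y \<in> carrier H\<rbrakk> \<Longrightarrow> hinner H x (a \<odot> y) = a * hinner H x y"
    and inner_commute:
      "\<lbrakk>x \<in> carrier H; y \<in> carrier H\<rbrakk> \<Longrightarrow> hinner H y x = cj (hinner H x y)"
    and inner_self: "x \<in> carrier H \<Longrightarrow> \<exists>r\<ge>0. hinner H x x = of_real r"
    and inner_eq_zero: "\<lbrakk>x \<in> carrier H; hinner H x x = 0\<rbrakk> \<Longrightarrow> x = \<zero>"
begin

section \<open>Sesquilinear algebra of the inner product\<close>

lemma scalar_simps [simp]:
  "carrier (ring_of_type_algebra :: 'k::real_normed_field ring) = UNIV"
  "a \<oplus>\<^bsub>ring_of_type_algebra\<^esub> b = a + b"
  "a \<otimes>\<^bsub>ring_of_type_algebra\<^esub> b = a * b"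
  "\<zero>\<^bsub>ring_of_type_algebra\<^esub> = 0"
  "\<one>\<^bsub>ring_of_type_algebra\<^esub> = 1"
  by (simp_all add: ring_of_type_algebra_def)

lemma cj_0 [simp]: "cj 0 = 0"
  using cj_of_real[of 0] by simp

lemma re_0 [simp]: "re 0 = 0"
  using re_of_real[of 0] by simp

lemma cj_sum: "cj (sum f A) = (\<Sum>i\<in>A. cj (f i))"
  by (induction A rule: infinite_finite_induct) (auto simp: cj_add)

lemma re_sum: "re (sum f A) = (\<Sum>i\<in>A. re (f i))"
  by (induction A rule: infinite_finite_induct) (auto simp: re_add)

lemma smult_carrier [simp]: "x \<in> carrier H \<Longrightarrow> a \<odot> x \<in> carrier H"
  using smult_closed by simp

lemma inner_add_left:
  "\<lbrakk>x \<in> carrier H; y \<in> carrier H; z \<in> carrier H\<rbrakk> \<Longrightarrow>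
    hinner H (x \<oplus> y) z = hinner H x z + hinner H y z"
  using inner_commute[of z "x \<oplus> y"] inner_commute[of z x] inner_commute[of z y]
  by (simp add: inner_add_right cj_add)

lemma inner_smult_left:
  "\<lbrakk>x \<in> carrier H; y \<in> carrier H\<rbrakk> \<Longrightarrow> hinner H (a \<odot> x) y = cj a * hinner H x y"
  using inner_commute[of y "a \<odot> x"] inner_commute[of y x]
  by (simp add: inner_smult_right cj_mult)

lemma inner_zero_right [simp]: "x \<in> carrier H \<Longrightarrow> hinner H x \<zero> = 0"
  using inner_add_right[of x \<zero> \<zero>] by simp

lemma diff_add_cancel: "\<lbrakk>x \<in> carrier H; y \<in> carrier H\<rbrakk> \<Longrightarrow> (x \<ominus> y) \<oplus> y = x"
  by (simp add: M.minus_eq M.add.m_assoc M.l_neg)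

lemma inner_minus_right:
  assumes "x \<in> carrier H" "y \<in> carrier H" "z \<in> carrier H"
  shows "hinner H x (y \<ominus> z) = hinner H x y - hinner H x z"
proof -
  have "hinner H x y = hinner H x ((y \<ominus> z) \<oplus> z)"
    using assms by (simp add: diff_add_cancel)
  also have "\<dots> = hinner H x (y \<ominus> z) + hinner H x z"
    using assms by (simp add: inner_add_right)
  finally show ?thesis by simp
qed

lemma inner_minus_left:
  assumes "x \<in> carrier H" "y \<in> carrier H" "z \<in> carrier H"
  shows "hinner H (y \<ominus> z) x = hinner H y x - hinner H z x"
proof -
  have "hinner H y x = hinner H ((y \<ominus> z) \<oplus> z) x"
    using assms by (simp add: diff_add_cancel)
  also have "\<dots> = hinner H (y \<ominus> z) x + hinner H z x"
    using assms by (simp add: inner_add_left)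
  finally show ?thesis by simp
qed

lemma inner_finsum_right:
  "\<lbrakk>x \<in> carrier H; f \<in> A \<rightarrow> carrier H; finite A\<rbrakk> \<Longrightarrow>
    hinner H x (finsum H f A) = (\<Sum>i\<in>A. hinner H x (f i))"
proof (induction A rule: infinite_finite_induct)
  case (insert a A)
  then have "f \<in> A \<rightarrow> carrier H" "f a \<in> carrier H" by auto
  with insert show ?case by (simp add: M.finsum_insert inner_add_right M.finsum_closed)
qed auto

lemma inner_finsum_left:
  assumes "x \<in> carrier H" "f \<in> A \<rightarrow> carrier H" "finite A"
  shows "hinner H (finsum H f A) x = (\<Sum>i\<in>A. hinner H (f i) x)"
proof -
  have fc: "f i \<in> carrier H" if "i \<in> A" for i using assms(2) that by blast
  have "hinner H (finsum H f A) x = cj (\<Sum>i\<in>A. hinner H x (f i))"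
    using assms inner_commute[of x "finsum H f A"] by (simp add: inner_finsum_right)
  also have "\<dots> = (\<Sum>i\<in>A. hinner H (f i) x)"
    unfolding cj_sum by (intro sum.cong refl) (simp add: inner_commute[OF assms(1) fc])
  finally show ?thesis .
qed

lemma re_inner_self_nonneg: "x \<in> carrier H \<Longrightarrow> 0 \<le> re (hinner H x x)"
  using inner_self[of x] by (auto simp: re_of_real)

lemma inner_self_re: "x \<in> carrier H \<Longrightarrow> hinner H x x = of_real (re (hinner H x x))"
  using inner_self[of x] by (auto simp: re_of_real)

text \<open>The double sum is the squared length of the combination of the \<open>g i\<close> with
  the real coefficients \<open>x i\<close>.\<close>

lemma inner_gram_nonneg:
  assumes "finite I" "g \<in> I \<rightarrow> carrier H"
  shows "0 \<le> (\<Sum>i\<in>I. \<Sum>j\<in>I. x i * re (hinner H (g i) (g j)) * x j)"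
proof -
  define y where "y i = of_real (x i) \<odot> g i" for i
  have y: "y \<in> I \<rightarrow> carrier H" using assms by (auto simp: y_def Pi_def)
  have "re (hinner H (finsum H y I) (finsum H y I)) = (\<Sum>i\<in>I. \<Sum>j\<in>I. re (hinner H (y i) (y j)))"
    using assms y
    by (simp add: inner_finsum_left inner_finsum_right M.finsum_closed re_sum Pi_def)
      (rule sum.swap)
  also have "\<dots> = (\<Sum>i\<in>I. \<Sum>j\<in>I. x i * re (hinner H (g i) (g j)) * x j)"
  proof (intro sum.cong refl)
    fix i j assume "i \<in> I" "j \<in> I"
    then have "hinner H (y i) (y j) = of_real (x i * x j) * hinner H (g i) (g j)"
      using assms by (simp add: y_def Pi_def inner_smult_left inner_smult_right cj_of_real)
    then show "re (hinner H (y i) (y j)) = x i * re (hinner H (g i) (g j)) * x j"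
      by (simp only: re_of_real_mult) simp
  qed
  finally show ?thesis
    using y by (metis M.finsum_closed re_inner_self_nonneg)
qed

text \<open>The \<open>y v\<close> are orthogonal components of \<open>x\<close>, so their sum
  \<open>s\<close> satisfies <s|s> = <s|x> and is orthogonal to the remainder
  \<open>x \<ominus> s\<close>. Applied to projections, this shows both that a remainder vanishes
  and that an edge sum of projections lies below the identity.\<close>

lemma inner_orthogonal_remainder:
  assumes "finite e" "x \<in> carrier H" and y: "y \<in> e \<rightarrow> carrier H"
    and orth: "\<And>u v. \<lbrakk>u \<in> e; v \<in> e; u \<noteq> v\<rbrakk> \<Longrightarrow> hinner H (y u) (y v) = 0"
    and proj: "\<And>v. v \<in> e \<Longrightarrow> hinner H (y v) x = hinner H (y v) (y v)"
  shows "hinner H x (x \<ominus> finsum H y e) = hinner H (x \<ominus> finsum H y e) (x \<ominus> finsum H y e)"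
proof -
  define s where "s = finsum H y e"
  have s: "s \<in> carrier H" using y by (simp add: s_def M.finsum_closed)
  have yc: "y v \<in> carrier H" if "v \<in> e" for v using y that by auto
  have "hinner H (y u) s = hinner H (y u) x" if "u \<in> e" for u
  proof -
    have "hinner H (y u) s = (\<Sum>v\<in>e. hinner H (y u) (y v))"
      using assms yc that by (simp add: s_def inner_finsum_right)
    also have "\<dots> = (\<Sum>v\<in>e. if v = u then hinner H (y u) (y u) else 0)"
      by (intro sum.cong) (use orth that in auto)
    finally show ?thesis using assms that by simp
  qed
  then have "hinner H s s = hinner H s x"
    using assms s by (simp add: s_def inner_finsum_left)
  then show ?thesis
    using assms(2) s unfolding s_def[symmetric] by (simp add: inner_minus_right inner_minus_left)
qed

section \<open>From representations to \<open>Q1\<close> matrices\<close>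

text \<open>The matrix is the real part of the Gram matrix of \<open>\<Psi>\<close> and the
  \<open>\<phi> v\<close>; taking real parts treats both scalar fields at once. The column of
  \<open>None\<close> is found by expanding \<open>\<Psi>\<close> along an edge through
  \<open>v\<close>: only <phi_v|phi_v> survives.\<close>

lemma vector_decomposition_imp_Q1:
  assumes cs: "contextuality_scenario V E" and p: "p \<in> probabilistic_models V E"
    and vd: "vector_decomposition H V E p"
  shows "p \<in> Q1_models V E"
proof -
  obtain \<Psi> \<phi> where \<Psi>: "\<Psi> \<in> carrier H" "hinner H \<Psi> \<Psi> = 1" and \<phi>: "\<phi> \<in> V \<rightarrow> carrier H"
    and orth: "\<And>u v. \<lbrakk>u \<in> V; v \<in> V; orthogonal_vertices E u v\<rbrakk> \<Longrightarrow> hinner H (\<phi> u) (\<phi> v) = 0"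
    and sum: "\<And>e. e \<in> E \<Longrightarrow> finsum H \<phi> e = \<Psi>"
    and pv: "\<And>v. v \<in> V \<Longrightarrow> of_real (p v) = hinner H (\<phi> v) (\<phi> v)"
    using vd unfolding vector_decomposition_def unit_vector_def by blast
  have V: "finite V" "\<And>e. e \<in> E \<Longrightarrow> e \<subseteq> V" "\<And>v. v \<in> V \<Longrightarrow> \<exists>e\<in>E. v \<in> e"
    using cs unfolding contextuality_scenario_def by auto
  define I where "I = insert None (Some ` V)"
  define g where "g i = (case i of None \<Rightarrow> \<Psi> | Some v \<Rightarrow> \<phi> v)" for i
  have I: "finite I" and g: "g \<in> I \<rightarrow> carrier H"
    using V \<Psi> \<phi> by (auto simp: I_def g_def)
  define A where "A i j = re (hinner H (g i) (g j))" for i j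
  have gc: "g i \<in> carrier H" if "i \<in> I" for i using that g by auto
  have A_sym: "A i j = A j i" if "i \<in> I" "j \<in> I" for i j
    using inner_commute[OF gc gc, OF that] by (simp add: A_def re_cj)
  have "0 \<le> Re (\<Sum>i\<in>I. \<Sum>j\<in>I. cnj (x i) * of_real (A i j) * x j)" for x
  proof -
    \<comment> \<open>As \<open>A\<close> is real, each term splits into a product of real parts and
      a product of imaginary parts, which leaves two real forms.\<close>
    have "Re (\<Sum>i\<in>I. \<Sum>j\<in>I. cnj (x i) * of_real (A i j) * x j) =
      (\<Sum>i\<in>I. \<Sum>j\<in>I. Re (x i) * A i j * Re (x j)) + (\<Sum>i\<in>I. \<Sum>j\<in>I. Im (x i) * A i j * Im (x j))"
      by (simp add: sum.distrib algebra_simps)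
    then show ?thesis
      using inner_gram_nonneg[OF I g, of "\<lambda>i. Re (x i)"] inner_gram_nonneg[OF I g, of "\<lambda>i. Im (x i)"]
      by (simp add: A_def)
  qed
  then have "positive_semidefinite_on I (\<lambda>i j. complex_of_real (A i j))"
    unfolding positive_semidefinite_on_def using A_sym by auto
  moreover have "complex_of_real (A None None) = 1"
    using \<Psi> re_of_real[of 1] by (simp add: A_def g_def)
  moreover have "(\<Sum>x\<in>e. complex_of_real (A (Some x) w)) = of_real (A None w)"
    if "e \<in> E" "w \<in> I" for e w
  proof -
    have "\<phi> \<in> e \<rightarrow> carrier H" "finite e" using \<phi> V that finite_subset by blast+
    then have "(\<Sum>x\<in>e. A (Some x) w) = re (hinner H (finsum H \<phi> e) (g w))"
      using gc[OF that(2)] by (simp add: A_def g_def inner_finsum_left re_sum)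
    then show ?thesis using sum[OF that(1)] by (simp add: A_def g_def flip: of_real_sum)
  qed
  moreover have "complex_of_real (A (Some u) (Some v)) = 0"
    if "u \<in> V" "v \<in> V" "orthogonal_vertices E u v" for u v
    using orth that by (simp add: A_def g_def)
  moreover have "complex_of_real (p v) = of_real (A (Some v) None)" if v: "v \<in> V" for v
  proof -
    obtain e where e: "e \<in> E" "v \<in> e" using V v by blast
    have ec: "\<phi> \<in> e \<rightarrow> carrier H" "finite e" "e \<subseteq> V" using \<phi> V e finite_subset by blast+
    have "hinner H (\<phi> v) \<Psi> = (\<Sum>u\<in>e. hinner H (\<phi> v) (\<phi> u))"
      using inner_finsum_right[of "\<phi> v" \<phi> e] ec e \<phi> v by (auto simp: sum)
    also have "\<dots> = (\<Sum>u\<in>e. if u = v then hinner H (\<phi> v) (\<phi> v) else 0)"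
      by (intro sum.cong) (use e ec v in \<open>auto intro!: orth simp: orthogonal_vertices_def\<close>)
    also have "\<dots> = of_real (p v)" using e ec v pv by simp
    finally show ?thesis by (simp add: A_def g_def re_of_real)
  qed
  moreover have "p \<in> V \<rightarrow> {0..1}" using p by (simp add: probabilistic_models_def)
  ultimately show ?thesis unfolding Q1_models_def I_def by blast
qed

lemma rank_one_projection:
  assumes "unit_vector H w"
  shows "projection_on H (\<lambda>x. hinner H w x \<odot> w)"
proof -
  have w: "w \<in> carrier H" "hinner H w w = 1" using assms by (auto simp: unit_vector_def)
  have "hinner H (hinner H w x \<odot> w) y = hinner H x (hinner H w y \<odot> w)"
    if "x \<in> carrier H" "y \<in> carrier H" for x y
    using w that inner_commute[of w x] by (simp add: inner_smult_left inner_smult_right)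
  then show ?thesis
    using w smult_l_distr smult_assoc1
    by (auto simp: projection_on_def inner_add_right inner_smult_right)
qed

text \<open>\<open>P v\<close> projects onto the line of \<open>\<psi> v\<close>. The product of two
  such projections carries the factor <psi_u|psi_v>, and the expectation at \<open>\<Psi>\<close> is
  the squared modulus of <psi_v|Psi>.\<close>

lemma unit_vector_representation_imp_orthogonal_projection_representation:
  assumes "unit_vector_representation H V E p"
  shows "orthogonal_projection_representation H V E p"
proof -
  obtain \<Psi> \<psi> where \<Psi>: "unit_vector H \<Psi>" and \<psi>: "\<And>v. v \<in> V \<Longrightarrow> unit_vector H (\<psi> v)"
    and orth: "\<And>u v. \<lbrakk>u \<in> V; v \<in> V; orthogonal_vertices E u v\<rbrakk> \<Longrightarrow> hinner H (\<psi> u) (\<psi> v) = 0"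
    and pv: "\<And>v. v \<in> V \<Longrightarrow> p v = (norm (hinner H (\<psi> v) \<Psi>))\<^sup>2"
    using assms unfolding unit_vector_representation_def by blast
  define P where "P v x = hinner H (\<psi> v) x \<odot> \<psi> v" for v x
  have c: "\<Psi> \<in> carrier H" "v \<in> V \<Longrightarrow> \<psi> v \<in> carrier H" for v
    using \<Psi> \<psi> by (auto simp: unit_vector_def)
  have "projection_on H (P v)" if "v \<in> V" for v
    unfolding P_def using rank_one_projection \<psi> that by blast
  moreover have "P u (P v x) = \<zero>"
    if "u \<in> V" "v \<in> V" "orthogonal_vertices E u v" "x \<in> carrier H" for u v x
    using that orth c smult_l_null[of "\<psi> u"] by (simp add: P_def inner_smult_right)
  moreover have "of_real (p v) = hinner H \<Psi> (P v \<Psi>)" if "v \<in> V" for v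
    using pv[OF that] c that inner_commute[of "\<psi> v" \<Psi>] cj_mult_self[of "hinner H (\<psi> v) \<Psi>"]
    by (simp add: P_def inner_smult_right mult.commute)
  ultimately show ?thesis
    using \<Psi> unfolding orthogonal_projection_representation_def by blast
qed

lemma projection_inner:
  assumes "projection_on H P" "x \<in> carrier H"
  shows "hinner H (P x) x = hinner H (P x) (P x)"
  using assms unfolding projection_on_def by (metis PiE)

lemma projection_carrier: "\<lbrakk>projection_on H P; x \<in> carrier H\<rbrakk> \<Longrightarrow> P x \<in> carrier H"
  unfolding projection_on_def by blast

text \<open>Self-adjointness gives <Px|Qx> = <x|P(Qx)>.\<close>

lemma orthogonal_projections_inner:
  assumes "projection_on H P" "projection_on H Q" "x \<in> carrier H" "P (Q x) = \<zero>"
  shows "hinner H (P x) (Q x) = 0"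
  using assms unfolding projection_on_def by (metis PiE inner_zero_right)

text \<open>The vectors are \<open>P v \<Psi>\<close>. Over an edge the remainder of
  \<open>\<Psi>\<close> has squared length 1 minus the sum of the \<open>p v\<close>, which is 0
  because \<open>p\<close> is normalized.\<close>

lemma orthogonal_projection_representation_imp_vector_decomposition:
  assumes cs: "contextuality_scenario V E" and p: "p \<in> probabilistic_models V E"
    and "orthogonal_projection_representation H V E p"
  shows "vector_decomposition H V E p"
proof -
  obtain \<Psi> P where \<Psi>: "unit_vector H \<Psi>" and P: "\<And>v. v \<in> V \<Longrightarrow> projection_on H (P v)"
    and orth: "\<And>u v x. \<lbrakk>u \<in> V; v \<in> V; orthogonal_vertices E u v; x \<in> carrier H\<rbrakk> \<Longrightarrow> P u (P v x) = \<zero>"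
    and pv: "\<And>v. v \<in> V \<Longrightarrow> of_real (p v) = hinner H \<Psi> (P v \<Psi>)"
    using assms(3) unfolding orthogonal_projection_representation_def by blast
  have \<Psi>c: "\<Psi> \<in> carrier H" "hinner H \<Psi> \<Psi> = 1" using \<Psi> by (auto simp: unit_vector_def)
  define \<phi> where "\<phi> v = P v \<Psi>" for v
  have \<phi>: "\<phi> \<in> V \<rightarrow> carrier H" using P \<Psi>c projection_carrier by (auto simp: \<phi>_def)
  have o: "hinner H (\<phi> u) (\<phi> v) = 0" if "u \<in> V" "v \<in> V" "orthogonal_vertices E u v" for u v
    using that P orth \<Psi>c orthogonal_projections_inner by (simp add: \<phi>_def)
  have pp: "of_real (p v) = hinner H (\<phi> v) (\<phi> v)" if "v \<in> V" for v
    using that pv projection_inner[OF P \<Psi>c(1)] inner_commute[of "\<phi> v" \<Psi>] \<phi> \<Psi>c cj_of_real[of "p v"]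
      inner_commute[of \<Psi> "\<phi> v"]
    by (auto simp: \<phi>_def Pi_def)
  have "finsum H \<phi> e = \<Psi>" if e: "e \<in> E" for e
  proof -
    have eV: "e \<subseteq> V" "finite e"
      using cs e finite_subset unfolding contextuality_scenario_def by blast+
    then have ec: "\<phi> \<in> e \<rightarrow> carrier H" using \<phi> by blast
    then have sc: "finsum H \<phi> e \<in> carrier H" by (rule M.finsum_closed)
    have "hinner H \<Psi> (\<Psi> \<ominus> finsum H \<phi> e) = 1 - (\<Sum>v\<in>e. hinner H \<Psi> (\<phi> v))"
      using \<Psi>c ec sc eV by (simp add: inner_minus_right inner_finsum_right)
    also have "(\<Sum>v\<in>e. hinner H \<Psi> (\<phi> v)) = (\<Sum>v\<in>e. of_real (p v))"
      by (intro sum.cong) (use eV pv in \<open>auto simp: \<phi>_def\<close>)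
    also have "\<dots> = 1"
      using p e by (simp add: probabilistic_models_def flip: of_real_sum)
    finally have "hinner H \<Psi> (\<Psi> \<ominus> finsum H \<phi> e) = 0" by simp
    moreover have "hinner H \<Psi> (\<Psi> \<ominus> finsum H \<phi> e) =
        hinner H (\<Psi> \<ominus> finsum H \<phi> e) (\<Psi> \<ominus> finsum H \<phi> e)"
    proof (rule inner_orthogonal_remainder)
      show "hinner H (\<phi> u) (\<phi> v) = 0" if "u \<in> e" "v \<in> e" "u \<noteq> v" for u v
        using that o eV e by (auto simp: orthogonal_vertices_def)
      show "hinner H (\<phi> v) \<Psi> = hinner H (\<phi> v) (\<phi> v)" if "v \<in> e" for v
        using projection_inner[OF P \<Psi>c(1)] that eV by (auto simp: \<phi>_def)
    qed (use eV \<Psi>c ec in auto)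
    ultimately have "\<Psi> \<ominus> finsum H \<phi> e = \<zero>"
      using inner_eq_zero \<Psi>c sc by simp
    then show ?thesis using \<Psi>c sc diff_add_cancel[of \<Psi> "finsum H \<phi> e"] by simp
  qed
  then show ?thesis
    unfolding vector_decomposition_def using \<Psi> \<phi> o pp by blast
qed

text \<open>Along an edge the vectors \<open>P v x\<close> are orthogonal components of
  \<open>x\<close>, so <x|(1 - T)x> is the squared length of the remainder, where \<open>T\<close>
  is the sum of the projections.\<close>

lemma orthogonal_projection_representation_imp_subnormalized:
  assumes cs: "contextuality_scenario V E"
    and "orthogonal_projection_representation H V E p"
  shows "subnormalized_projection_representation H V E p"
proof -
  obtain \<Psi> P where \<Psi>: "unit_vector H \<Psi>" and P: "\<And>v. v \<in> V \<Longrightarrow> projection_on H (P v)"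
    and orth: "\<And>u v x. \<lbrakk>u \<in> V; v \<in> V; orthogonal_vertices E u v; x \<in> carrier H\<rbrakk> \<Longrightarrow> P u (P v x) = \<zero>"
    and pv: "\<And>v. v \<in> V \<Longrightarrow> of_real (p v) = hinner H \<Psi> (P v \<Psi>)"
    using assms(2) unfolding orthogonal_projection_representation_def by blast
  have "below_identity H (\<lambda>x. finsum H (\<lambda>v. P v x) e)" if e: "e \<in> E" for e
    unfolding below_identity_def
  proof
    fix x assume x: "x \<in> carrier H"
    define z where "z = x \<ominus> finsum H (\<lambda>v. P v x) e"
    have eV: "e \<subseteq> V" "finite e"
      using cs e finite_subset unfolding contextuality_scenario_def by blast+
    have ec: "(\<lambda>v. P v x) \<in> e \<rightarrow> carrier H" using eV P x projection_carrier by blast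
    have z: "z \<in> carrier H" using x ec by (simp add: z_def M.finsum_closed)
    have "hinner H x z = hinner H z z"
      unfolding z_def
    proof (rule inner_orthogonal_remainder)
      show "hinner H (P u x) (P v x) = 0" if "u \<in> e" "v \<in> e" "u \<noteq> v" for u v
        using that eV e x P orth[of u v x]
        by (intro orthogonal_projections_inner) (auto simp: orthogonal_vertices_def)
      show "hinner H (P v x) x = hinner H (P v x) (P v x)" if "v \<in> e" for v
        using projection_inner P x that eV by blast
    qed (use eV x ec in auto)
    then show "\<exists>r\<ge>0. hinner H x (x \<ominus> finsum H (\<lambda>v. P v x) e) = of_real r"
      using inner_self[OF z] by (simp add: z_def)
  qed
  then show ?thesis
    unfolding subnormalized_projection_representation_def using \<Psi> P pv by blast
qed

text \<open>The inequality is tested at a vector \<open>x\<close> in the range of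
  \<open>P v\<close>. There <x|P_v x> = <x|x> exhausts the bound, so the other nonnegative terms
  <x|P_w x> of the edge must vanish, and <x|P_u x> is the squared length of
  \<open>P u x\<close>.\<close>

lemma subnormalized_imp_orthogonal_projection_representation:
  assumes cs: "contextuality_scenario V E"
    and "subnormalized_projection_representation H V E p"
  shows "orthogonal_projection_representation H V E p"
proof -
  obtain \<Psi> P where \<Psi>: "unit_vector H \<Psi>" and P: "\<And>v. v \<in> V \<Longrightarrow> projection_on H (P v)"
    and below: "\<And>e. e \<in> E \<Longrightarrow> below_identity H (\<lambda>x. finsum H (\<lambda>v. P v x) e)"
    and pv: "\<And>v. v \<in> V \<Longrightarrow> of_real (p v) = hinner H \<Psi> (P v \<Psi>)"
    using assms(2) unfolding subnormalized_projection_representation_def by blast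
  have "P u (P v y) = \<zero>"
    if uv: "u \<in> V" "v \<in> V" "orthogonal_vertices E u v" and y: "y \<in> carrier H" for u v y
  proof -
    obtain e where e: "e \<in> E" "u \<in> e" "v \<in> e" "u \<noteq> v"
      using uv by (auto simp: orthogonal_vertices_def)
    have eV: "e \<subseteq> V" "finite e"
      using cs e finite_subset unfolding contextuality_scenario_def by blast+
    define x where "x = P v y"
    have x: "x \<in> carrier H" and Pvx: "P v x = x"
      using P[OF uv(2)] y unfolding x_def projection_on_def by auto
    have Pc: "P w x \<in> carrier H" if "w \<in> e" for w
      using that eV P x projection_carrier by blast
    define q where "q w = re (hinner H (P w x) (P w x))" for w
    have q0: "0 \<le> q w" if "w \<in> e" for w
      using Pc that re_inner_self_nonneg by (simp add: q_def)
    have eq: "hinner H x (P w x) = of_real (q w)" if "w \<in> e" for w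
    proof -
      have "hinner H (P w x) x = of_real (q w)"
        using projection_inner[of "P w" x] P eV that x Pc inner_self_re by (auto simp: q_def)
      then show ?thesis using inner_commute[of "P w x" x] Pc that x cj_of_real by simp
    qed
    obtain r :: real where r: "0 \<le> r" "hinner H x (x \<ominus> finsum H (\<lambda>v. P v x) e) = of_real r"
      using below[OF e(1)] x unfolding below_identity_def by blast
    have "hinner H x (x \<ominus> finsum H (\<lambda>v. P v x) e) = hinner H x x - (\<Sum>w\<in>e. hinner H x (P w x))"
      using x Pc eV by (simp add: inner_minus_right inner_finsum_right M.finsum_closed Pi_def)
    \<comment> \<open>Since \<open>P v\<close> fixes \<open>x\<close>, the squared length of
      \<open>x\<close> is \<open>q v\<close>.\<close>
    also have "\<dots> = of_real (q v - sum q e)"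
      using eq eq[OF e(3)] Pvx by simp
    finally have "r = q v - sum q e" using r by (metis of_real_eq_iff)
    moreover have "sum q e = q v + (q u + sum q (e - {v} - {u}))"
      using e eV sum.remove[of e v q] sum.remove[of "e - {v}" u q] by simp
    moreover have "0 \<le> sum q (e - {v} - {u})" by (intro sum_nonneg) (use q0 in auto)
    ultimately have "q u = 0" using r q0[OF e(2)] by linarith
    then have "hinner H (P u x) (P u x) = 0"
      using inner_self_re[OF Pc[OF e(2)]] by (simp add: q_def)
    then show ?thesis using inner_eq_zero Pc e by (simp add: x_def)
  qed
  then show ?thesis
    unfolding orthogonal_projection_representation_def using \<Psi> P pv by blast
qed

section \<open>Real combinations of an orthonormal family\<close>

text \<open>Carries real coordinate vectors into a space over either scalar field, so that vectors
  constructed once over the reals serve both.\<close>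

definition combination :: "'v set \<Rightarrow> ('v \<Rightarrow> 'h) \<Rightarrow> ('v \<Rightarrow> real) \<Rightarrow> 'h" where
  "combination V b c = finsum H (\<lambda>v. of_real (c v) \<odot> b v) V"

lemma combination_closed [simp]: "b \<in> V \<rightarrow> carrier H \<Longrightarrow> combination V b c \<in> carrier H"
  unfolding combination_def by (intro M.finsum_closed) auto

lemma combination_cong: "\<lbrakk>b \<in> V \<rightarrow> carrier H; \<And>v. v \<in> V \<Longrightarrow> c v = d v\<rbrakk> \<Longrightarrow>
    combination V b c = combination V b d"
  unfolding combination_def by (intro M.finsum_cong') auto

lemma combination_add:
  assumes "b \<in> V \<rightarrow> carrier H"
  shows "combination V b (\<lambda>v. c v + d v) = combination V b c \<oplus> combination V b d"
proof -
  have bc: "b v \<in> carrier H" if "v \<in> V" for v using assms that by blast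
  have "combination V b (\<lambda>v. c v + d v) = finsum H (\<lambda>v. of_real (c v) \<odot> b v \<oplus> of_real (d v) \<odot> b v) V"
    unfolding combination_def using bc by (intro M.finsum_cong' refl) (auto simp: smult_l_distr[simplified])
  also have "\<dots> = combination V b c \<oplus> combination V b d"
    unfolding combination_def using bc by (intro M.finsum_addf) auto
  finally show ?thesis .
qed

lemma combination_zero:
  assumes "b \<in> V \<rightarrow> carrier H"
  shows "combination V b (\<lambda>v. 0) = \<zero>"
proof -
  have "combination V b (\<lambda>v. 0) = finsum H (\<lambda>v. \<zero>) V"
    unfolding combination_def using assms smult_l_null by (intro M.finsum_cong') auto
  then show ?thesis by simp
qed

lemma combination_sum:
  assumes "finite e" "b \<in> V \<rightarrow> carrier H"
  shows "finsum H (\<lambda>u. combination V b (c u)) e = combination V b (\<lambda>v. \<Sum>u\<in>e. c u v)"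
  using assms(1)
proof (induction e)
  case (insert u e)
  then show ?case using assms(2)
    by (simp add: M.finsum_insert combination_add)
qed (simp add: combination_zero assms)

text \<open>Conjugation fixes the real coefficients, so an orthonormal \<open>b\<close> makes the
  passage from coordinates to vectors preserve the real dot product.\<close>

lemma inner_combination:
  assumes "finite V" and b: "b \<in> V \<rightarrow> carrier H"
    and orthonormal: "\<And>u v. \<lbrakk>u \<in> V; v \<in> V\<rbrakk> \<Longrightarrow> hinner H (b u) (b v) = (if u = v then 1 else 0)"
  shows "hinner H (combination V b c) (combination V b d) = of_real (\<Sum>v\<in>V. c v * d v)"
proof -
  have bc: "b v \<in> carrier H" if "v \<in> V" for v using b that by blast
  have "hinner H (combination V b c) (combination V b d) =
      (\<Sum>u\<in>V. hinner H (of_real (c u) \<odot> b u) (combination V b d))"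
    unfolding combination_def[of V b c] using assms bc by (intro inner_finsum_left) auto
  also have "\<dots> = (\<Sum>u\<in>V. \<Sum>v\<in>V. hinner H (of_real (c u) \<odot> b u) (of_real (d v) \<odot> b v))"
    unfolding combination_def using assms bc by (intro sum.cong inner_finsum_right refl) auto
  also have "\<dots> = (\<Sum>u\<in>V. \<Sum>v\<in>V. if v = u then of_real (c u * d u) else 0)"
    by (intro sum.cong refl)
      (auto simp: bc inner_smult_left inner_smult_right cj_of_real orthonormal)
  also have "\<dots> = of_real (\<Sum>v\<in>V. c v * d v)"
    using assms by simp
  finally show ?thesis .
qed

end

section \<open>Real vectors from Q1 matrices\<close>

text \<open>The index \<open>None\<close> is dropped before the factorization, so the coordinates
  are indexed by \<open>V\<close> alone; its vector is recovered as the common edge sum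
  \<open>s\<close>. The last clause keeps the coordinates of vertices of probability 0 free for
  later use.\<close>

lemma Q1_imp_real_vectors:
  assumes cs: "contextuality_scenario V E" and Q: "p \<in> Q1_models V E"
  shows "\<exists>(f :: 'v \<Rightarrow> 'v \<Rightarrow> real) s.
    (\<forall>u\<in>V. \<forall>v\<in>V. orthogonal_vertices E u v \<longrightarrow> (\<Sum>k\<in>V. f u k * f v k) = 0) \<and>
    (\<forall>e\<in>E. \<forall>k\<in>V. (\<Sum>v\<in>e. f v k) = s k) \<and>
    (\<forall>v\<in>V. (\<Sum>k\<in>V. f v k * f v k) = p v) \<and>
    (\<Sum>k\<in>V. s k * s k) = 1 \<and>
    (\<forall>u\<in>V. \<forall>k\<in>V. p k = 0 \<longrightarrow> f u k = 0)"
proof -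
  have V: "finite V" "V \<noteq> {}" "\<And>e. e \<in> E \<Longrightarrow> e \<subseteq> V" "\<And>v. v \<in> V \<Longrightarrow> \<exists>e\<in>E. v \<in> e"
    using cs unfolding contextuality_scenario_def by auto
  have fin: "finite e" if "e \<in> E" for e using V that finite_subset by blast
  obtain M where psd: "positive_semidefinite_on (insert None (Some ` V)) M"
    and M1: "M None None = 1"
    and Msum: "\<And>e w. \<lbrakk>e \<in> E; w \<in> insert None (Some ` V)\<rbrakk> \<Longrightarrow> (\<Sum>x\<in>e. M (Some x) w) = M None w"
    and Morth: "\<And>u v. \<lbrakk>u \<in> V; v \<in> V; orthogonal_vertices E u v\<rbrakk> \<Longrightarrow> M (Some u) (Some v) = 0"
    and Mp: "\<And>v. v \<in> V \<Longrightarrow> complex_of_real (p v) = M (Some v) None"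
    using Q unfolding Q1_models_def by blast
  have herm: "M j i = cnj (M i j)" if "i \<in> insert None (Some ` V)" "j \<in> insert None (Some ` V)" for i j
    using psd that unfolding positive_semidefinite_on_def by blast
  have MpN: "Re (M None (Some v)) = p v" if "v \<in> V" for v
    using herm[of "Some v" None] Mp[OF that, symmetric] that by simp
  define A where "A u v = Re (M (Some u) (Some v))" for u v
  have A_sym: "A u v = A v u" if "u \<in> V" "v \<in> V" for u v
    using herm[of "Some u" "Some v"] that by (simp add: A_def)
  have A_sum: "(\<Sum>u\<in>e. A u v) = p v" if "e \<in> E" "v \<in> V" for e v
    using Msum[of e "Some v"] MpN[of v] that by (simp add: A_def flip: Re_sum)
  have A_orth: "A u v = 0" if "u \<in> V" "v \<in> V" "orthogonal_vertices E u v" for u v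
    using Morth that by (simp add: A_def)
  \<comment> \<open>In the column of \<open>v\<close>, summed over an edge through \<open>v\<close>,
    orthogonality leaves only the diagonal entry.\<close>
  have A_diag: "A v v = p v" if v: "v \<in> V" for v
  proof -
    obtain e where e: "e \<in> E" "v \<in> e" using V v by blast
    have "(\<Sum>u\<in>e. A u v) = (\<Sum>u\<in>e. if u = v then A v v else 0)"
      by (intro sum.cong refl) (use e V v in \<open>auto intro!: A_orth simp: orthogonal_vertices_def\<close>)
    then show ?thesis using A_sum[OF e(1) v] e fin by simp
  qed
  have p_sum: "(\<Sum>v\<in>e. p v) = 1" if "e \<in> E" for e
  proof -
    have "complex_of_real (\<Sum>v\<in>e. p v) = (\<Sum>v\<in>e. M (Some v) None)"
      unfolding of_real_sum by (intro sum.cong refl) (use Mp V that in blast)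
    also have "\<dots> = 1" using Msum[OF that, of None] M1 by simp
    finally show ?thesis by (metis of_real_eq_1_iff)
  qed
  have "0 \<le> (\<Sum>i\<in>V. \<Sum>j\<in>V. x i * A i j * x j)" for x
  proof -
    \<comment> \<open>The entry 0 at \<open>None\<close> restricts the complex form to the
      vertices.\<close>
    define z where "z i = (case i of None \<Rightarrow> 0 | Some v \<Rightarrow> complex_of_real (x v))" for i
    have "0 \<le> Re (\<Sum>i\<in>insert None (Some ` V). \<Sum>j\<in>insert None (Some ` V). cnj (z i) * M i j * z j)"
      using psd unfolding positive_semidefinite_on_def by blast
    also have "\<dots> = (\<Sum>i\<in>V. \<Sum>j\<in>V. x i * A i j * x j)"
      using V by (simp add: z_def A_def sum.reindex)
    finally show ?thesis .
  qed
  from psd_gram[OF V(1) A_sym this] obtain f where f: "\<And>u v. \<lbrakk>u \<in> V; v \<in> V\<rbrakk> \<Longrightarrow> A u v = (\<Sum>k\<in>V. f u k * f v k)"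
    and f0: "\<And>u k. \<lbrakk>u \<in> V; k \<in> V; A k k = 0\<rbrakk> \<Longrightarrow> f u k = 0"
    by blast
  define t where "t e k = (\<Sum>v\<in>e. f v k)" for e k
  \<comment> \<open>The inner product of two edge sums is the sum of \<open>A\<close> over both
    edges. Its column sums are the \<open>p v\<close>, which add up to 1.\<close>
  have tt: "(\<Sum>k\<in>V. t e k * t e' k) = 1" if "e \<in> E" "e' \<in> E" for e e'
  proof -
    have "(\<Sum>k\<in>V. t e k * t e' k) = (\<Sum>k\<in>V. \<Sum>v\<in>e'. \<Sum>u\<in>e. f u k * f v k)"
      unfolding t_def sum_product by (subst sum.swap) simp
    also have "\<dots> = (\<Sum>v\<in>e'. \<Sum>k\<in>V. \<Sum>u\<in>e. f u k * f v k)"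
      by (rule sum.swap)
    also have "\<dots> = (\<Sum>v\<in>e'. \<Sum>u\<in>e. \<Sum>k\<in>V. f u k * f v k)"
      by (intro sum.cong refl sum.swap)
    also have "\<dots> = (\<Sum>v\<in>e'. \<Sum>u\<in>e. A u v)"
      by (intro sum.cong refl f[symmetric]) (use V that in blast)+
    also have "\<dots> = (\<Sum>v\<in>e'. p v)"
      by (intro sum.cong refl A_sum) (use V that in blast)+
    finally show ?thesis using p_sum that by simp
  qed
  obtain e0 where e0: "e0 \<in> E" using V by blast
  have "t e k = t e0 k" if "e \<in> E" "k \<in> V" for e k
  proof -
    \<comment> \<open>By \<open>tt\<close> the squared distance of two edge sums is 1 - 2 + 1 =
      0.\<close>
    have "(\<Sum>k\<in>V. (t e k - t e0 k)\<^sup>2) =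
        (\<Sum>k\<in>V. t e k * t e k) - 2 * (\<Sum>k\<in>V. t e k * t e0 k) + (\<Sum>k\<in>V. t e0 k * t e0 k)"
      by (simp add: power2_eq_square algebra_simps sum.distrib sum_subtractf sum_distrib_left)
    then have "(\<Sum>k\<in>V. (t e k - t e0 k)\<^sup>2) = 0" using tt that e0 by simp
    then show ?thesis using V that by (simp add: sum_nonneg_eq_0_iff)
  qed
  then have "(\<Sum>v\<in>e. f v k) = t e0 k" if "e \<in> E" "k \<in> V" for e k
    using that by (metis t_def)
  moreover have "(\<Sum>k\<in>V. f u k * f v k) = 0" if "u \<in> V" "v \<in> V" "orthogonal_vertices E u v" for u v
    using f[of u v] A_orth[of u v] that by simp
  moreover have "(\<Sum>k\<in>V. f v k * f v k) = p v" if "v \<in> V" for v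
    using f[of v v] A_diag[of v] that by simp
  moreover have "f u k = 0" if "u \<in> V" "k \<in> V" "p k = 0" for u k
    using f0[of u k] A_diag[of k] that by simp
  ultimately show ?thesis
    using tt[OF e0 e0] by (intro exI[of _ f] exI[of _ "t e0"]) blast
qed

section \<open>From \<open>Q1\<close> matrices to representations\<close>

context inner_product_module
begin

lemma Q1_imp_vector_decomposition:
  assumes cs: "contextuality_scenario V E" and Q: "p \<in> Q1_models V E"
    and b: "b \<in> V \<rightarrow> carrier H"
    and orthonormal: "\<And>u v. \<lbrakk>u \<in> V; v \<in> V\<rbrakk> \<Longrightarrow> hinner H (b u) (b v) = (if u = v then 1 else 0)"
  shows "vector_decomposition H V E p"
proof -
  have V: "finite V" "\<And>e. e \<in> E \<Longrightarrow> finite e"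
    using cs finite_subset unfolding contextuality_scenario_def by blast+
  obtain f s where f: "\<And>u v. \<lbrakk>u \<in> V; v \<in> V; orthogonal_vertices E u v\<rbrakk> \<Longrightarrow> (\<Sum>k\<in>V. f u k * f v k) = 0"
    "\<And>e k. \<lbrakk>e \<in> E; k \<in> V\<rbrakk> \<Longrightarrow> (\<Sum>v\<in>e. f v k) = s k"
    "\<And>v. v \<in> V \<Longrightarrow> (\<Sum>k\<in>V. f v k * f v k) = p v" "(\<Sum>k\<in>V. s k * s k) = 1"
    using Q1_imp_real_vectors[OF cs Q] by blast
  note inner = inner_combination[OF V(1) b orthonormal]
  show ?thesis
    unfolding vector_decomposition_def
  proof (intro exI conjI ballI impI)
    show "unit_vector H (combination V b s)"
      using b f(4) by (simp add: unit_vector_def inner)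
    show "(\<lambda>v. combination V b (f v)) \<in> V \<rightarrow> carrier H" using b by simp
    show "finsum H (\<lambda>v. combination V b (f v)) e = combination V b s" if "e \<in> E" for e
      using combination_sum[OF V(2)[OF that] b, of f] combination_cong[OF b f(2)[OF that]] by simp
  qed (simp_all add: inner f)
qed

text \<open>A vertex of probability \<open>0\<close> has \<open>f v = 0\<close>.  It is assigned the basis vector \<open>b v\<close> instead,
  which is orthogonal to all \<open>f u\<close> because these have no component along such \<open>v\<close>.\<close>

lemma Q1_imp_unit_vector_representation:
  assumes cs: "contextuality_scenario V E" and Q: "p \<in> Q1_models V E"
    and b: "b \<in> V \<rightarrow> carrier H"
    and orthonormal: "\<And>u v. \<lbrakk>u \<in> V; v \<in> V\<rbrakk> \<Longrightarrow> hinner H (b u) (b v) = (if u = v then 1 else 0)"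
  shows "unit_vector_representation H V E p"
proof -
  have V: "finite V" "\<And>e. e \<in> E \<Longrightarrow> e \<subseteq> V" "\<And>e. e \<in> E \<Longrightarrow> finite e"
    "\<And>v. v \<in> V \<Longrightarrow> \<exists>e\<in>E. v \<in> e"
    using cs finite_subset unfolding contextuality_scenario_def by blast+
  have p0: "0 \<le> p v" if "v \<in> V" for v using Q that by (auto simp: Q1_models_def)
  obtain f s where orth: "\<And>u v. \<lbrakk>u \<in> V; v \<in> V; orthogonal_vertices E u v\<rbrakk> \<Longrightarrow> (\<Sum>k\<in>V. f u k * f v k) = 0"
    and fs: "\<And>e k. \<lbrakk>e \<in> E; k \<in> V\<rbrakk> \<Longrightarrow> (\<Sum>v\<in>e. f v k) = s k"
    and fp: "\<And>v. v \<in> V \<Longrightarrow> (\<Sum>k\<in>V. f v k * f v k) = p v"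
    and s: "(\<Sum>k\<in>V. s k * s k) = 1"
    and f0: "\<And>u k. \<lbrakk>u \<in> V; k \<in> V; p k = 0\<rbrakk> \<Longrightarrow> f u k = 0"
    using Q1_imp_real_vectors[OF cs Q] by blast
  \<comment> \<open>Expand \<open>s\<close> along an edge through \<open>v\<close>; orthogonality
    leaves the squared length of \<open>f v\<close>.\<close>
  have fsp: "(\<Sum>k\<in>V. f v k * s k) = p v" if v: "v \<in> V" for v
  proof -
    obtain e where e: "e \<in> E" "v \<in> e" using V v by blast
    have "(\<Sum>k\<in>V. f v k * s k) = (\<Sum>k\<in>V. \<Sum>u\<in>e. f v k * f u k)"
      by (intro sum.cong refl) (simp add: fs[OF e(1), symmetric] sum_distrib_left)
    also have "\<dots> = (\<Sum>u\<in>e. \<Sum>k\<in>V. f v k * f u k)" by (rule sum.swap)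
    also have "\<dots> = (\<Sum>u\<in>e. if u = v then p v else 0)"
      by (intro sum.cong refl)
        (use e V v in \<open>auto intro!: orth simp: orthogonal_vertices_def fp\<close>)
    finally show ?thesis using e V by simp
  qed
  \<comment> \<open>As an edge sum of the \<open>f u\<close>, also \<open>s\<close> has no component
    along a vertex of probability 0.\<close>
  have s0: "s k = 0" if k: "k \<in> V" "p k = 0" for k
  proof -
    obtain e where e: "e \<in> E" using V k by blast
    show ?thesis unfolding fs[OF e k(1), symmetric] by (intro sum.neutral) (use f0 k V e in blast)
  qed
  define g where "g v k = (if p v = 0 then if k = v then 1 else 0 else f v k / sqrt (p v))" for v k
  have gg: "(\<Sum>k\<in>V. g v k * g v k) = 1" if "v \<in> V" for v
  proof (cases "p v = 0")
    case True
    have "(\<Sum>k\<in>V. g v k * g v k) = (\<Sum>k\<in>V. if k = v then 1 else 0)"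
      by (intro sum.cong) (auto simp: g_def True)
    then show ?thesis using V that by simp
  next
    case False
    then show ?thesis using p0[OF that] fp[OF that]
      by (simp add: g_def flip: sum_divide_distrib)
  qed
  have g0: "(\<Sum>k\<in>V. g u k * g v k) = 0"
    if "u \<in> V" "v \<in> V" "orthogonal_vertices E u v" for u v
  proof (cases "p u = 0 \<or> p v = 0")
    case True
    \<comment> \<open>Two vertices of probability 0 carry distinct basis vectors; if only one has
      probability 0, the other vector has no entry at its coordinate.\<close>
    have "g u k * g v k = 0" if "k \<in> V" for k
      using True that f0 \<open>u \<in> V\<close> \<open>v \<in> V\<close> \<open>orthogonal_vertices E u v\<close>
      by (auto simp: g_def orthogonal_vertices_def)
    then show ?thesis by (intro sum.neutral) blast
  next
    case False
    then show ?thesis using orth that by (simp add: g_def flip: sum_divide_distrib)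
  qed
  have gs: "(\<Sum>k\<in>V. g v k * s k)\<^sup>2 = p v" if "v \<in> V" for v
  proof (cases "p v = 0")
    case True
    have "(\<Sum>k\<in>V. g v k * s k) = 0"
      by (intro sum.neutral) (use True s0 in \<open>auto simp: g_def\<close>)
    then show ?thesis using True by simp
  next
    case False
    then have "(\<Sum>k\<in>V. g v k * s k) = p v / sqrt (p v)"
      using fsp that by (simp add: g_def flip: sum_divide_distrib)
    then show ?thesis using p0[OF that] by (simp add: real_div_sqrt)
  qed
  note inner = inner_combination[OF V(1) b orthonormal]
  show ?thesis
    unfolding unit_vector_representation_def
  proof (intro exI conjI ballI impI)
    show "unit_vector H (combination V b s)"
      using b s by (simp add: unit_vector_def inner)
    show "unit_vector H (combination V b (g v))" if "v \<in> V" for v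
      using b gg that by (simp add: unit_vector_def inner)
    show "p v = (norm (hinner H (combination V b (g v)) (combination V b s)))\<^sup>2" if "v \<in> V" for v
      using gs that by (simp add: inner del: of_real_sum of_real_mult)
  qed (simp add: inner g0)
qed

text \<open>All routes pass through \<open>vector_decomposition\<close>: unit vectors and
  subnormalized projections both yield orthogonal projections, and these yield vectors. This
  direction is valid in any dimension.\<close>

lemma representation_imp_Q1:
  assumes cs: "contextuality_scenario V E" and p: "p \<in> probabilistic_models V E"
    and "vector_decomposition H V E p \<or> unit_vector_representation H V E p \<or>
      orthogonal_projection_representation H V E p \<or> subnormalized_projection_representation H V E p"
  shows "p \<in> Q1_models V E"
  using assms(3) vector_decomposition_imp_Q1[OF cs p]
    unit_vector_representation_imp_orthogonal_projection_representation[of V E p]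
    orthogonal_projection_representation_imp_vector_decomposition[OF cs p]
    subnormalized_imp_orthogonal_projection_representation[OF cs, of p]
  by blast

text \<open>The orthonormal family provides the dimensions for the real vectors. Both kinds of
  projections are then obtained from the unit vectors.\<close>

lemma Q1_iff_representations:
  assumes cs: "contextuality_scenario V E" and p: "p \<in> probabilistic_models V E"
    and b: "b \<in> V \<rightarrow> carrier H"
    and orthonormal: "\<And>u v. \<lbrakk>u \<in> V; v \<in> V\<rbrakk> \<Longrightarrow> hinner H (b u) (b v) = (if u = v then 1 else 0)"
  shows "p \<in> Q1_models V E \<longleftrightarrow> vector_decomposition H V E p"
    and "p \<in> Q1_models V E \<longleftrightarrow> unit_vector_representation H V E p"
    and "p \<in> Q1_models V E \<longleftrightarrow> orthogonal_projection_representation H V E p"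
    and "p \<in> Q1_models V E \<longleftrightarrow> subnormalized_projection_representation H V E p"
  using representation_imp_Q1[OF cs p]
    unit_vector_representation_imp_orthogonal_projection_representation[of V E p]
    orthogonal_projection_representation_imp_subnormalized[OF cs, of p]
    Q1_imp_vector_decomposition[OF cs _ b orthonormal, of p]
    Q1_imp_unit_vector_representation[OF cs _ b orthonormal, of p]
  by blast+

end

section \<open>Complex and Euclidean spaces\<close>

text \<open>Conjugate symmetry makes <x|x> real, so nonnegativity of its real part yields the form
  required by \<open>inner_self\<close>.\<close>

lemma complex_hilbert_space_imp_inner_product_module:
  assumes "complex_hilbert_space H"
  shows "inner_product_module H cnj Re"
proof -
  interpret complex_hilbert_space H by fact
  have "\<exists>r\<ge>0. hinner H x x = complex_of_real r" if "x \<in> carrier H" for x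
  proof -
    have "Im (hinner H x x) = 0"
      using hinner_commute[OF that that] by (simp add: complex_eq_iff)
    then show ?thesis
      using hinner_nonneg[OF that] by (intro exI[of _ "Re (hinner H x x)"]) (simp add: complex_eq_iff)
  qed
  then show ?thesis
    by unfold_locales
      (simp_all add: hinner_add_right hinner_smult_right hinner_eq_zero hinner_commute[symmetric]
        complex_norm_square mult.commute del: of_real_power)
qed

lemma inner_product_module_euclidean:
  "inner_product_module (euclidean_hspace :: (real, real ^ 'n) hspace) (\<lambda>a. a) (\<lambda>a. a)"
proof -
  have "abelian_group (euclidean_hspace :: (real, real ^ 'n) hspace)"
  proof (rule abelian_groupI)
    show "\<exists>y\<in>carrier euclidean_hspace. y \<oplus>\<^bsub>euclidean_hspace\<^esub> x = \<zero>\<^bsub>euclidean_hspace\<^esub>"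
      for x :: "real ^ 'n"
      by (auto simp: euclidean_hspace_def intro: exI[of _ "- x"])
  qed (auto simp: euclidean_hspace_def algebra_simps)
  then have "module (ring_of_type_algebra :: real ring) (euclidean_hspace :: (real, real ^ 'n) hspace)"
    by (intro moduleI cring_from_type_algebra)
      (auto simp: euclidean_hspace_def ring_of_type_algebra_def algebra_simps)
  then show ?thesis
    unfolding inner_product_module_def inner_product_module_axioms_def
    by (auto simp: euclidean_hspace_def inner_add_right inner_commute power2_eq_square)
qed

text \<open>The space of complex functions on \<open>V\<close>, carried over to another type along an injection
  \<open>j\<close> of the extensional functions.\<close>

definition coordinates :: "'v set \<Rightarrow> (('v \<Rightarrow> complex) \<Rightarrow> 'h) \<Rightarrow> 'h \<Rightarrow> 'v \<Rightarrow> complex" where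
  "coordinates V j = inv_into (V \<rightarrow>\<^sub>E UNIV) j"

definition coordinate_hspace :: "'v set \<Rightarrow> (('v \<Rightarrow> complex) \<Rightarrow> 'h) \<Rightarrow> (complex, 'h) hspace" where
  "coordinate_hspace V j =
     \<lparr>carrier = j ` (V \<rightarrow>\<^sub>E UNIV), monoid.mult = undefined, one = undefined,
      ring.zero = j (\<lambda>v\<in>V. 0),
      add = (\<lambda>x y. j (\<lambda>v\<in>V. coordinates V j x v + coordinates V j y v)),
      module.smult = (\<lambda>a x. j (\<lambda>v\<in>V. a * coordinates V j x v)),
      hinner = (\<lambda>x y. \<Sum>v\<in>V. cnj (coordinates V j x v) * coordinates V j y v)\<rparr>"

text \<open>Realizes the complex space of dimension \<open>card V\<close> on a prescribed vector
  type; it will witness the existence of a Hilbert space over \<open>'h\<close>.\<close>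

locale coordinate_space =
  fixes V :: "'v set" and j :: "('v \<Rightarrow> complex) \<Rightarrow> 'h"
  assumes finite_V: "finite V" and inj_j: "inj_on j (V \<rightarrow>\<^sub>E UNIV)"
begin

abbreviation "H \<equiv> coordinate_hspace V j"
abbreviation "c \<equiv> coordinates V j"

lemma coordinates_j [simp]: "v \<in> V \<Longrightarrow> c (j (restrict f V)) v = f v"
  using inv_into_f_f[OF inj_j, of "restrict f V"] by (simp add: coordinates_def)

lemma j_carrier [simp]: "j (restrict f V) \<in> carrier H"
  by (simp add: coordinate_hspace_def)

text \<open>By injectivity of \<open>j\<close>, coordinates determine elements of the carrier. The
  algebraic axioms can thus be checked coordinate by coordinate.\<close>

lemma carrier_eqI:
  assumes "x \<in> carrier H" "y \<in> carrier H" "\<And>v. v \<in> V \<Longrightarrow> c x v = c y v"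
  shows "x = y"
proof -
  obtain f g where fg: "x = j f" "y = j g" "f \<in> V \<rightarrow>\<^sub>E UNIV" "g \<in> V \<rightarrow>\<^sub>E UNIV"
    using assms(1,2) by (auto simp: coordinate_hspace_def)
  then have "c x = f" "c y = g"
    using inj_j by (simp_all add: coordinates_def)
  then have "f = g"
    using assms(3) fg by (metis PiE_ext)
  then show ?thesis using fg by simp
qed

lemma H_simps:
  "x \<oplus>\<^bsub>H\<^esub> y = j (\<lambda>v\<in>V. c x v + c y v)"
  "\<zero>\<^bsub>H\<^esub> = j (\<lambda>v\<in>V. 0)"
  "a \<odot>\<^bsub>H\<^esub> x = j (\<lambda>v\<in>V. a * c x v)"
  "hinner H x y = (\<Sum>v\<in>V. cnj (c x v) * c y v)"
  by (simp_all add: coordinate_hspace_def)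

lemma inner_product_module_coordinate: "inner_product_module H cnj Re"
proof -
  have "abelian_group H"
  proof (rule abelian_groupI)
    show "\<exists>y\<in>carrier H. y \<oplus>\<^bsub>H\<^esub> x = \<zero>\<^bsub>H\<^esub>" for x
      by (intro bexI[of _ "j (\<lambda>v\<in>V. - c x v)"] carrier_eqI) (simp_all add: H_simps)
  qed (auto intro!: carrier_eqI simp: H_simps)
  then have "module (ring_of_type_algebra :: complex ring) H"
    by (intro moduleI cring_from_type_algebra)
      (auto intro!: carrier_eqI simp: H_simps ring_of_type_algebra_def algebra_simps)
  moreover have "\<exists>r\<ge>0. hinner H x x = complex_of_real r" for x
    by (intro exI[of _ "\<Sum>v\<in>V. (norm (c x v))\<^sup>2"])
      (simp add: H_simps sum_nonneg complex_norm_square mult.commute del: of_real_power)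
  moreover have "x = \<zero>\<^bsub>H\<^esub>" if "x \<in> carrier H" "hinner H x x = 0" for x
  proof (rule carrier_eqI)
    have "complex_of_real (\<Sum>v\<in>V. (norm (c x v))\<^sup>2) = 0"
      using that by (simp add: H_simps complex_norm_square mult.commute del: of_real_power)
    then have "(\<Sum>v\<in>V. (norm (c x v))\<^sup>2) = 0" by (simp only: of_real_eq_0_iff)
    then show "c x v = c \<zero>\<^bsub>H\<^esub> v" if "v \<in> V" for v
      using that finite_V by (simp add: sum_nonneg_eq_0_iff H_simps)
  qed (simp_all add: that H_simps)
  ultimately show ?thesis
    unfolding inner_product_module_def inner_product_module_axioms_def
    by (auto simp: H_simps sum.distrib sum_distrib_left algebra_simps complex_norm_square
        simp del: of_real_power)
qed

sublocale inner_product_module H cnj Re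
  by (rule inner_product_module_coordinate)

text \<open>The axioms of \<open>Metric_space\<close> demand symmetry also outside the carrier, so differences are
  computed for arbitrary elements of the type.\<close>

lemma coordinates_diff:
  assumes "v \<in> V"
  shows "c (x \<ominus>\<^bsub>H\<^esub> y) v = c x v - c y v"
proof -
  \<comment> \<open>The negative is a definite description. It is well defined even for
    \<open>y\<close> outside the carrier, since addition sees \<open>y\<close> only through its
    coordinates.\<close>
  have "\<ominus>\<^bsub>H\<^esub> y = j (\<lambda>v\<in>V. - c y v)"
    unfolding a_inv_def m_inv_def
  proof (rule the_equality)
    fix z assume "z \<in> carrier (add_monoid H) \<and>
      y \<otimes>\<^bsub>add_monoid H\<^esub> z = \<one>\<^bsub>add_monoid H\<^esub> \<and> z \<otimes>\<^bsub>add_monoid H\<^esub> y = \<one>\<^bsub>add_monoid H\<^esub>"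
    then have z: "z \<in> carrier H" "y \<oplus>\<^bsub>H\<^esub> z = \<zero>\<^bsub>H\<^esub>" by simp_all
    show "z = j (\<lambda>v\<in>V. - c y v)"
    proof (rule carrier_eqI)
      fix v assume v: "v \<in> V"
      have "c (y \<oplus>\<^bsub>H\<^esub> z) v = c \<zero>\<^bsub>H\<^esub> v" using z by simp
      then have "c y v + c z v = 0" using v by (simp add: H_simps)
      then show "c z v = c (j (\<lambda>v\<in>V. - c y v)) v" using v by (simp add: eq_neg_iff_add_eq_0 add.commute)
    qed (use z in simp_all)
  qed (auto intro!: carrier_eqI simp: H_simps)
  then show ?thesis using assms by (simp add: a_minus_def H_simps)
qed

text \<open>Holding for all elements of the type, this identifies the two distances as functions,
  which allows rewriting inside \<open>mcomplete\<close>.\<close>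

lemma hinner_distance_eq:
  "sqrt (Re (hinner H (x \<ominus>\<^bsub>H\<^esub> y) (x \<ominus>\<^bsub>H\<^esub> y))) = L2_set (\<lambda>v. cmod (c x v - c y v)) V"
proof -
  have "hinner H (x \<ominus>\<^bsub>H\<^esub> y) (x \<ominus>\<^bsub>H\<^esub> y) = complex_of_real (\<Sum>v\<in>V. (cmod (c x v - c y v))\<^sup>2)"
    unfolding H_simps of_real_sum
    by (intro sum.cong refl)
      (simp add: coordinates_diff complex_norm_square mult.commute del: of_real_power)
  then show ?thesis by (simp add: L2_set_def)
qed

lemma Metric_space_coordinate:
  "Metric_space (carrier H) (\<lambda>x y. L2_set (\<lambda>v. cmod (c x v - c y v)) V)"
proof
  show "L2_set (\<lambda>v. cmod (c x v - c y v)) V = L2_set (\<lambda>v. cmod (c y v - c x v)) V" for x y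
    by (simp add: norm_minus_commute)
  show "(L2_set (\<lambda>v. cmod (c x v - c y v)) V = 0) = (x = y)"
    if "x \<in> carrier H" "y \<in> carrier H" for x y
    using that finite_V by (auto simp: L2_set_eq_0_iff intro: carrier_eqI)
  show "L2_set (\<lambda>v. cmod (c x v - c z v)) V \<le>
      L2_set (\<lambda>v. cmod (c x v - c y v)) V + L2_set (\<lambda>v. cmod (c y v - c z v)) V" for x y z
  proof -
    have "L2_set (\<lambda>v. cmod (c x v - c z v)) V \<le>
        L2_set (\<lambda>v. cmod (c x v - c y v) + cmod (c y v - c z v)) V"
      by (intro L2_set_mono) (auto intro: norm_diff_triangle_le)
    also have "\<dots> \<le> L2_set (\<lambda>v. cmod (c x v - c y v)) V + L2_set (\<lambda>v. cmod (c y v - c z v)) V"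
      by (rule L2_set_triangle_ineq)
    finally show ?thesis .
  qed
qed simp

text \<open>Each coordinate distance is at most the total distance, so coordinates of Cauchy
  sequences converge in the complex numbers. Conversely the distance to the assembled limit is at
  most the finite sum of the coordinate distances.\<close>

lemma mcomplete_coordinate:
  "Metric_space.mcomplete (carrier H) (\<lambda>x y. L2_set (\<lambda>v. cmod (c x v - c y v)) V)"
proof -
  interpret Metric_space "carrier H" "\<lambda>x y. L2_set (\<lambda>v. cmod (c x v - c y v)) V"
    by (rule Metric_space_coordinate)
  show ?thesis
    unfolding mcomplete_def
  proof (intro allI impI)
    fix \<sigma> assume \<sigma>: "MCauchy \<sigma>"
    have "convergent (\<lambda>n. c (\<sigma> n) v)" if v: "v \<in> V" for v
    proof -
      have "Cauchy (\<lambda>n. c (\<sigma> n) v)"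
      proof (rule metric_CauchyI)
        fix e :: real assume "0 < e"
        then obtain N where N: "\<And>m n. \<lbrakk>N \<le> m; N \<le> n\<rbrakk> \<Longrightarrow>
            L2_set (\<lambda>v. cmod (c (\<sigma> m) v - c (\<sigma> n) v)) V < e"
          using \<sigma> unfolding MCauchy_def by blast
        show "\<exists>N. \<forall>m\<ge>N. \<forall>n\<ge>N. dist (c (\<sigma> m) v) (c (\<sigma> n) v) < e"
        proof (intro exI[of _ N] allI impI)
          fix m n assume "N \<le> m" "N \<le> n"
          have "dist (c (\<sigma> m) v) (c (\<sigma> n) v) \<le> L2_set (\<lambda>v. cmod (c (\<sigma> m) v - c (\<sigma> n) v)) V"
            unfolding dist_norm by (rule member_le_L2_set[OF finite_V v])
          also have "\<dots> < e" by (rule N) fact+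
          finally show "dist (c (\<sigma> m) v) (c (\<sigma> n) v) < e" .
        qed
      qed
      then show ?thesis by (rule Cauchy_convergent)
    qed
    then have lim: "(\<lambda>n. c (\<sigma> n) v) \<longlonglongrightarrow> lim (\<lambda>n. c (\<sigma> n) v)" if "v \<in> V" for v
      using that by (simp add: convergent_LIMSEQ_iff)
    define l where "l = j (\<lambda>v\<in>V. lim (\<lambda>n. c (\<sigma> n) v))"
    have l: "c l v = lim (\<lambda>n. c (\<sigma> n) v)" if "v \<in> V" for v using that by (simp add: l_def)
    have "(\<lambda>n. c (\<sigma> n) v - c l v) \<longlonglongrightarrow> 0" if "v \<in> V" for v
      using tendsto_diff[OF lim[OF that] tendsto_const[of "c l v"]] l[OF that] by simp
    then have "(\<lambda>n. \<Sum>v\<in>V. cmod (c (\<sigma> n) v - c l v)) \<longlonglongrightarrow> 0"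
      by (intro tendsto_null_sum tendsto_norm_zero) blast
    then have "(\<lambda>n. L2_set (\<lambda>v. cmod (c (\<sigma> n) v - c l v)) V) \<longlonglongrightarrow> 0"
      by (rule tendsto_sandwich[where f = "\<lambda>_. 0", rotated 3])
        (auto intro!: always_eventually L2_set_le_sum)
    moreover have "\<sigma> n \<in> carrier H" for n using \<sigma> unfolding MCauchy_def by blast
    ultimately show "\<exists>x. limitin mtopology \<sigma> x sequentially"
      by (intro exI[of _ l]) (simp add: limitin_metric_dist_null l_def)
  qed
qed

lemma complex_hilbert_space_coordinate: "complex_hilbert_space H"
proof unfold_locales
  show "Metric_space.mcomplete (carrier H) (\<lambda>x y. sqrt (Re (hinner H (x \<ominus>\<^bsub>H\<^esub> y) (x \<ominus>\<^bsub>H\<^esub> y))))"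
    using mcomplete_coordinate by (simp add: hinner_distance_eq)
qed (simp_all add: inner_add_right inner_smult_right re_inner_self_nonneg inner_eq_zero
    inner_commute[symmetric])

definition basis :: "'v \<Rightarrow> 'h" where
  "basis u = j (\<lambda>v\<in>V. if v = u then 1 else 0)"

lemma basis_carrier: "basis u \<in> carrier H"
  by (simp add: basis_def)

lemma basis_orthonormal:
  assumes "u \<in> V" "w \<in> V"
  shows "hinner H (basis u) (basis w) = (if u = w then 1 else 0)"
proof -
  have "hinner H (basis u) (basis w) = (\<Sum>v\<in>V. if v = u then if u = w then 1 else 0 else 0)"
    unfolding H_simps basis_def by (intro sum.cong) auto
  then show ?thesis using assms finite_V by simp
qed

end

section \<open>Coding finitely many coordinates by one\<close>

lemma inj_pairing_infinite:
  assumes "infinite (UNIV :: 'a set)"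
  obtains \<pi> :: "'a \<times> 'a \<Rightarrow> 'a" where "inj \<pi>"
proof -
  have "\<exists>\<pi>. bij_betw \<pi> ((UNIV :: 'a set) \<times> (UNIV :: 'a set)) (UNIV :: 'a set)"
    unfolding card_of_ordIso using assms by (rule card_of_Times_same_infinite)
  then show thesis
    using that by (auto simp: bij_betw_def)
qed

text \<open>By induction on \<open>V\<close>, a function is coded by pairing its value at the new
  point with the code of its restriction. For complex values this compresses all coordinates into a
  single complex number.\<close>

lemma inj_on_extensional_infinite:
  assumes "infinite (UNIV :: 'a set)" "finite V"
  shows "\<exists>g :: ('v \<Rightarrow> 'a) \<Rightarrow> 'a. inj_on g (V \<rightarrow>\<^sub>E UNIV)"
  using assms(2)
proof induction
  case (insert v V)
  obtain \<pi> :: "'a \<times> 'a \<Rightarrow> 'a" where \<pi>: "inj \<pi>" using inj_pairing_infinite[OF assms(1)] .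
  obtain g :: "('v \<Rightarrow> 'a) \<Rightarrow> 'a" where g: "inj_on g (V \<rightarrow>\<^sub>E UNIV)" using insert.IH by blast
  have "inj_on (\<lambda>f. \<pi> (f v, g (restrict f V))) (insert v V \<rightarrow>\<^sub>E UNIV)"
  proof (rule inj_onI)
    fix f h :: "'v \<Rightarrow> 'a"
    assume fh: "f \<in> insert v V \<rightarrow>\<^sub>E UNIV" "h \<in> insert v V \<rightarrow>\<^sub>E UNIV"
      and "\<pi> (f v, g (restrict f V)) = \<pi> (h v, g (restrict h V))"
    then have eq: "f v = h v" "g (restrict f V) = g (restrict h V)"
      using \<pi> by (auto dest: injD)
    have "restrict f V = restrict h V"
      using inj_onD[OF g, OF eq(2)] by auto
    then have "f u = h u" if "u \<in> V" for u using that by (metis restrict_apply')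
    then show "f = h" using fh eq by (intro PiE_ext[OF fh]) auto
  qed
  then show ?case by blast
qed (auto simp: inj_on_def)

text \<open>The standard basis, relabelled by a bijection between \<open>V\<close> and the index
  type.\<close>

lemma euclidean_orthonormal_family:
  assumes "finite V" "CARD('n::finite) = card V"
  obtains b :: "'v \<Rightarrow> real ^ 'n" where "b \<in> V \<rightarrow> carrier euclidean_hspace"
    and "\<And>u v. \<lbrakk>u \<in> V; v \<in> V\<rbrakk> \<Longrightarrow> hinner euclidean_hspace (b u) (b v) = (if u = v then 1 else 0)"
proof -
  obtain h where h: "bij_betw h V (UNIV :: 'n set)"
    using finite_same_card_bij[OF assms(1), of "UNIV :: 'n set"] assms(2) by auto
  show thesis
    by (rule that[of "\<lambda>v. axis (h v) 1"])
      (use h in \<open>auto simp: euclidean_hspace_def inner_axis_axis bij_betw_def inj_on_def\<close>)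
qed

(* The Hilbert spaces range over those whose vectors are elements of 'h.  Since 'h is arbitrary,
   this covers all of them; the map emb only excludes types 'h that are too small to carry any
   Hilbert space with a unit vector. *)
theorem proposition6p3p1:
  fixes V :: "'v set" and E :: "'v set set" and p :: "'v \<Rightarrow> real"
    and emb :: "complex \<Rightarrow> 'h"
  assumes "contextuality_scenario V E"
    and "p \<in> probabilistic_models V E"
    and "inj emb"
  shows
    "(p \<in> Q1_models V E \<longleftrightarrow>
        (\<exists>H :: (complex, 'h) hspace. complex_hilbert_space H \<and>
           vector_decomposition H V E p)) \<and>
     (p \<in> Q1_models V E \<longleftrightarrow>
        (\<exists>H :: (complex, 'h) hspace. complex_hilbert_space H \<and>
           unit_vector_representation H V E p)) \<and>
     (p \<in> Q1_models V E \<longleftrightarrow>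
        (\<exists>H :: (complex, 'h) hspace. complex_hilbert_space H \<and>
           orthogonal_projection_representation H V E p)) \<and>
     (p \<in> Q1_models V E \<longleftrightarrow>
        (\<exists>H :: (complex, 'h) hspace. complex_hilbert_space H \<and>
           subnormalized_projection_representation H V E p)) \<and>
     (CARD('n::finite) = card V \<longrightarrow>
        (p \<in> Q1_models V E \<longleftrightarrow>
           vector_decomposition (euclidean_hspace :: (real, real ^ 'n) hspace) V E p) \<and>
        (p \<in> Q1_models V E \<longleftrightarrow>
           unit_vector_representation (euclidean_hspace :: (real, real ^ 'n) hspace) V E p) \<and>
        (p \<in> Q1_models V E \<longleftrightarrow>
           orthogonal_projection_representation
             (euclidean_hspace :: (real, real ^ 'n) hspace) V E p) \<and>
        (p \<in> Q1_models V E \<longleftrightarrow>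
           subnormalized_projection_representation
             (euclidean_hspace :: (real, real ^ 'n) hspace) V E p))"
proof -
  note cs = assms(1) and p = assms(2)
  have V: "finite V" using cs by (simp add: contextuality_scenario_def)
  \<comment> \<open>One complex number codes a whole coordinate vector, so \<open>emb\<close>
    suffices to place the coordinate space inside \<open>'h\<close>.\<close>
  obtain g :: "('v \<Rightarrow> complex) \<Rightarrow> complex" where g: "inj_on g (V \<rightarrow>\<^sub>E UNIV)"
    using inj_on_extensional_infinite[OF infinite_UNIV_char_0 V] by blast
  interpret C: coordinate_space V "emb \<circ> g"
    by unfold_locales (use V g assms(3) in \<open>auto intro: comp_inj_on inj_on_subset\<close>)
  have basis: "C.basis \<in> V \<rightarrow> carrier C.H" using C.basis_carrier by blast
  \<comment> \<open>Here \<open>R\<close> stands for any of the four kinds of representation: the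
    coordinate space is the witness in one direction, and an arbitrary \<open>H\<close> is handled
    in the other.\<close>
  have complex: "p \<in> Q1_models V E \<longleftrightarrow> (\<exists>H :: (complex, 'h) hspace. complex_hilbert_space H \<and> R H)"
    if "p \<in> Q1_models V E \<longleftrightarrow> R C.H"
      and "\<And>H. R H \<Longrightarrow> vector_decomposition H V E p \<or> unit_vector_representation H V E p \<or>
      orthogonal_projection_representation H V E p \<or> subnormalized_projection_representation H V E p"
    for R
  proof
    assume "p \<in> Q1_models V E"
    then show "\<exists>H :: (complex, 'h) hspace. complex_hilbert_space H \<and> R H"
      using that(1) C.complex_hilbert_space_coordinate by blast
  next
    assume "\<exists>H :: (complex, 'h) hspace. complex_hilbert_space H \<and> R H"
    then obtain H :: "(complex, 'h) hspace" where H: "complex_hilbert_space H" "R H" by blast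
    show "p \<in> Q1_models V E"
      by (rule inner_product_module.representation_imp_Q1
        [OF complex_hilbert_space_imp_inner_product_module[OF H(1)] cs p that(2)[OF H(2)]])
  qed
  have real: "CARD('n) = card V \<longrightarrow> (p \<in> Q1_models V E \<longleftrightarrow>
           vector_decomposition (euclidean_hspace :: (real, real ^ 'n) hspace) V E p) \<and>
        (p \<in> Q1_models V E \<longleftrightarrow>
           unit_vector_representation (euclidean_hspace :: (real, real ^ 'n) hspace) V E p) \<and>
        (p \<in> Q1_models V E \<longleftrightarrow>
           orthogonal_projection_representation
             (euclidean_hspace :: (real, real ^ 'n) hspace) V E p) \<and>
        (p \<in> Q1_models V E \<longleftrightarrow>
           subnormalized_projection_representation
             (euclidean_hspace :: (real, real ^ 'n) hspace) V E p)"
    (is "_ \<longrightarrow> ?Q")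
  proof
    assume card: "CARD('n) = card V"
    obtain b :: "'v \<Rightarrow> real ^ 'n" where b: "b \<in> V \<rightarrow> carrier euclidean_hspace"
      "\<And>u v. \<lbrakk>u \<in> V; v \<in> V\<rbrakk> \<Longrightarrow> hinner euclidean_hspace (b u) (b v) = (if u = v then 1 else 0)"
      using euclidean_orthonormal_family[OF V card] by blast
    show ?Q
      by (intro conjI inner_product_module.Q1_iff_representations
          [OF inner_product_module_euclidean cs p b])
  qed
  note C_iff = C.Q1_iff_representations[OF cs p basis C.basis_orthonormal, simplified]
  note c1 = complex[of "\<lambda>H. vector_decomposition H V E p", OF C_iff(1), simplified]
  note c2 = complex[of "\<lambda>H. unit_vector_representation H V E p", OF C_iff(2), simplified]
  note c3 = complex[of "\<lambda>H. orthogonal_projection_representation H V E p", OF C_iff(3), simplified]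
  note c4 = complex[of "\<lambda>H. subnormalized_projection_representation H V E p", OF C_iff(4), simplified]
  show ?thesis
    by (intro conjI[OF c1] conjI[OF c2] conjI[OF c3] conjI[OF c4] real)
qed

end
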